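(* Let $d,r$ be positive integers, and let $P$ be any set of $T(d,r)=(r-1)(d+1)+1$ points in the bounding box $\mathcal B\subset\mathbb R^d$ of a stretched grid such that every two points of $P$ are $(2d+3)$-far apart. Then $P$ has exactly $\bigl((r-1)!\bigr)^d$ Tverberg partitions.
   Context: Stretched grid. Let $m\ge 2$ be an integer (the side of the grid) and let $K_1,\dots,K_d$ be constants with $K_1=2$ and $K_i\ge 2d^2K_{i-1}^m$ for $2\le i\le d$. The stretched grid is $G_{\mathrm s}=\{(K_1^{a_1},\dots,K_d^{a_d}) : a_i\in\{0,\dots,m-1\}\}$, and its bounding box is $\mathcal B=[1,K_1^{m-1}]\times\cdots\times[1,K_d^{m-1}]$. For $p,q\in\mathcal B$ (not necessarily grid points), the stretched distance between $p$ and $q$ in direction $i$ is the number $c\ge 0$ with $p_i=K_i^c q_i$ or $q_i=K_i^c p_i$. The points $p,q$ are $c$-far apart if for every $i\in\{1,\dots,d\}$ their stretched distance in direction $i$ is at least $c$. A Tverberg partition of a set $P$ of $T(d,r)$ points in $\mathbb R^d$ is an (unordered) partition of $P$ into $r$ nonempty parts $P_1,\dots,P_r$ with $\bigcap_{i=1}^r\mathrm{conv}(P_i)\ne\emptyset$. *)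

theory Defs
  imports "HOL-Analysis.Analysis" "HOL-Library.Disjoint_Sets"
begin

(* The space R^d is real ^ 'd with d = CARD('d). The condition on the constants K relates
   consecutive coordinates, so the index type carries a linear order: the coordinates 1, ..., d
   are the elements of 'd in increasing order. Thus Min UNIV is the first coordinate, and
   Max {..<i} is the one immediately before i. *)

definition stretching_constants :: "nat \<Rightarrow> ('d::{finite,linorder} \<Rightarrow> real) \<Rightarrow> bool" where
  "stretching_constants m K \<longleftrightarrow>
     K (Min UNIV) = 2 \<and>
     (\<forall>i. i \<noteq> Min UNIV \<longrightarrow> K i \<ge> 2 * (real CARD('d))^2 * K (Max {..<i}) ^ m)"

definition stretched_grid :: "nat \<Rightarrow> ('d \<Rightarrow> real) \<Rightarrow> (real ^ 'd::{finite,linorder}) set" where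
  "stretched_grid m K = {(\<chi> i. K i ^ a i) | a. \<forall>i. a i \<in> {0..m - 1}}"

definition bounding_box :: "nat \<Rightarrow> ('d \<Rightarrow> real) \<Rightarrow> (real ^ 'd::{finite,linorder}) set" where
  "bounding_box m K = cbox (\<chi> i. 1) (\<chi> i. K i ^ (m - 1))"

(* The description has a unique solution for points of the bounding box, where all
   coordinates are positive and K i > 1. *)
definition stretched_dist ::
    "('d \<Rightarrow> real) \<Rightarrow> 'd \<Rightarrow> real ^ 'd::{finite,linorder} \<Rightarrow> real ^ 'd::{finite,linorder}
      \<Rightarrow> real" where
  "stretched_dist K i p q =
     (THE c. c \<ge> 0 \<and> (p $ i = K i powr c * q $ i \<or> q $ i = K i powr c * p $ i))"

definition far_apart ::
    "('d \<Rightarrow> real) \<Rightarrow> real \<Rightarrow> real ^ 'd::{finite,linorder} \<Rightarrow> real ^ 'd::{finite,linorder}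
      \<Rightarrow> bool" where
  "far_apart K c p q \<longleftrightarrow> (\<forall>i. stretched_dist K i p q \<ge> c)"

definition tverberg_number :: "nat \<Rightarrow> nat \<Rightarrow> nat" where
  "tverberg_number d r = (r - 1) * (d + 1) + 1"

definition tverberg_partitions :: "nat \<Rightarrow> 'a::real_vector set \<Rightarrow> 'a set set set" where
  "tverberg_partitions r P =
     {\<P>. partition_on P \<P> \<and> card \<P> = r \<and> (\<Inter>A\<in>\<P>. convex hull A) \<noteq> {}}"

lemma stretching_constants_ge_2:
  assumes "stretching_constants m K"
  shows "K i \<ge> 2"
proof (induction "card {..<i}" arbitrary: i rule: less_induct)
  case less
  show ?case
  proof (cases "i = Min UNIV")
    case True
    with assms show ?thesis by (simp add: stretching_constants_def)
  next
    case False
    let ?j = "Max {..<i}"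
    have "Min UNIV < i" using False by (simp add: order_less_le)
    then have "{..<i} \<noteq> {}" by auto
    then have "?j \<in> {..<i}" by (intro Max_in) auto
    then have ji: "?j < i" by simp
    then have "{..<?j} \<subset> {..<i}" by auto
    then have "card {..<?j} < card {..<i}" by (simp add: psubset_card_mono)
    then have "K ?j \<ge> 2" using less by blast
    then have "K ?j ^ m \<ge> 1" by (intro one_le_power) simp
    moreover have "(real CARD('a))^2 \<ge> 1" by (intro one_le_power) (simp add: Suc_le_eq)
    ultimately have "(real CARD('a))^2 * K ?j ^ m \<ge> 1 * 1" by (intro mult_mono) auto
    moreover have "K i \<ge> 2 * (real CARD('a))^2 * K ?j ^ m"
      using assms False by (simp add: stretching_constants_def)
    ultimately show ?thesis by linarith
  qed
qed

lemma bounding_box_least: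
  assumes "stretching_constants m K"
  shows "stretched_grid m K \<subseteq> cbox a b \<longleftrightarrow> bounding_box m K \<subseteq> cbox a b"
proof
  have K: "K i \<ge> 1" for i using stretching_constants_ge_2[OF assms, of i] by simp
  have "stretched_grid m K \<subseteq> bounding_box m K"
    using K by (auto simp: stretched_grid_def bounding_box_def mem_box_cart
        intro!: one_le_power power_increasing)
  then show "bounding_box m K \<subseteq> cbox a b \<Longrightarrow> stretched_grid m K \<subseteq> cbox a b" by blast
  assume sub: "stretched_grid m K \<subseteq> cbox a b"
  have "(\<chi> i. K i ^ 0) \<in> stretched_grid m K" unfolding stretched_grid_def
    by (intro CollectI exI[of _ "\<lambda>_. 0"]) simp
  moreover have "(\<chi> i. K i ^ (m - 1)) \<in> stretched_grid m K" unfolding stretched_grid_def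
    by (intro CollectI exI[of _ "\<lambda>_. m - 1"]) simp
  ultimately have "(\<chi> i. K i ^ 0) \<in> cbox a b" "(\<chi> i. K i ^ (m - 1)) \<in> cbox a b"
    using sub by blast+
  then show "bounding_box m K \<subseteq> cbox a b"
    by (fastforce simp: bounding_box_def mem_box_cart intro: order_trans)
qed

lemma stretched_dist_eqI:
  assumes "stretching_constants m K" and "p \<in> bounding_box m K" and "q \<in> bounding_box m K"
    and "c \<ge> 0" and "p $ i = K i powr c * q $ i \<or> q $ i = K i powr c * p $ i"
  shows "stretched_dist K i p q = c"
proof -
  have K: "K i > 1" using stretching_constants_ge_2[OF assms(1), of i] by simp
  have pq: "p $ i > 0" "q $ i > 0"
    using assms(2,3) by (auto simp: bounding_box_def mem_box_cart intro: less_le_trans[of 0 1])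
  have *: "c = \<bar>log (K i) (p $ i) - log (K i) (q $ i)\<bar>"
    if "c \<ge> 0" "p $ i = K i powr c * q $ i \<or> q $ i = K i powr c * p $ i" for c
    using that pq K by (auto simp: log_mult)
  show ?thesis unfolding stretched_dist_def
  proof (rule the_equality)
    show "c \<ge> 0 \<and> (p $ i = K i powr c * q $ i \<or> q $ i = K i powr c * p $ i)"
      using assms(4,5) by blast
  next
    fix c' assume "c' \<ge> 0 \<and> (p $ i = K i powr c' * q $ i \<or> q $ i = K i powr c' * p $ i)"
    then have "c' = \<bar>log (K i) (p $ i) - log (K i) (q $ i)\<bar>" using * by blast
    then show "c' = c" using *[OF assms(4,5)] by simp
  qed
qed

lemma stretched_dist_bounding_box:
  assumes "stretching_constants m K" and "p \<in> bounding_box m K" and "q \<in> bounding_box m K"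
  shows "stretched_dist K i p q = \<bar>log (K i) (p $ i) - log (K i) (q $ i)\<bar>"
proof (rule stretched_dist_eqI[OF assms])
  have K: "K i > 1" using stretching_constants_ge_2[OF assms(1), of i] by simp
  have "p $ i > 0" "q $ i > 0"
    using assms(2,3) by (auto simp: bounding_box_def mem_box_cart intro: less_le_trans[of 0 1])
  then show "p $ i = K i powr \<bar>log (K i) (p $ i) - log (K i) (q $ i)\<bar> * q $ i \<or>
      q $ i = K i powr \<bar>log (K i) (p $ i) - log (K i) (q $ i)\<bar> * p $ i"
    using K by (cases "log (K i) (p $ i) \<ge> log (K i) (q $ i)") (auto simp: powr_diff)
qed simp

end

(* Process the directions from the last to the first: among the remaining points, the r - 1 highest
   in direction k form level k and are removed, and the next highest is the pivot of direction k;
   the r points left at the end form level 0. A partition is Tverberg iff each part meets, for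
   every k, the set E k (level k with its pivot; for k = 0 just level 0) in exactly one point, and
   there are ((r - 1)!)^d such partitions: once the lower levels are distributed, the points of
   level k go bijectively to the parts not containing the pivot.

   Tverberg implies transversal: let x be a common point. By Markov's inequality each part
   contains, for each k, a point that is about as high as x or higher in direction k, and not much
   higher than x in all later directions. There are just enough points for this, and counting
   forces these points to be E k.

   Transversal implies Tverberg: minimize the sum of the squared distances from x to the hulls. The
   vectors c A from x to the nearest points sum to 0 and satisfy c A . (p - x) >= 0 on A. Rescale
   coordinates so that each point p, after scaling by its approximate weight, has coordinate 1 in
   the directions k with p in E k, and coordinates at most 4^-(d+1) in the others. The inequalities
   then bound all c A by a constant smaller than 1 times themselves, so they vanish. *)

theory Submission
  imports Defs
begin

section \<open>Greedy levels and transversal partitions\<close>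

text \<open>Level \<open>k > 0\<close> is meant to hold the \<open>r - 1\<close> points highest in direction \<open>k\<close> among those of
  level at most \<open>k\<close>, and \<open>piv k\<close> to be the next one; the order itself only enters below.\<close>

locale greedy_levels =
  fixes d r :: nat and P :: "'a set" and lv :: "'a \<Rightarrow> nat" and piv :: "nat \<Rightarrow> 'a"
  assumes r_pos: "r \<ge> 1"
    and fin: "finite P"
    and lv_le: "p \<in> P \<Longrightarrow> lv p \<le> d"
    and card_level0: "card {p \<in> P. lv p = 0} = r"
    and card_level: "0 < k \<Longrightarrow> k \<le> d \<Longrightarrow> card {p \<in> P. lv p = k} = r - 1"
    and piv_in: "0 < k \<Longrightarrow> k \<le> d \<Longrightarrow> piv k \<in> P"
    and lv_piv: "0 < k \<Longrightarrow> k \<le> d \<Longrightarrow> lv (piv k) < k"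
begin

text \<open>\<open>piv 0\<close> is unspecified, hence the guard \<open>0 < k\<close>. The levels
  partition \<open>P\<close>, whereas the sets \<open>E k\<close> overlap: each pivot also lies in
  the set of its own, lower level.\<close>

definition E :: "nat \<Rightarrow> 'a set" where
  "E k = {p \<in> P. lv p = k \<or> 0 < k \<and> p = piv k}"

definition transversal_partitions :: "'a set set set" where
  "transversal_partitions = {\<P>. partition_on P \<P> \<and> (\<forall>A\<in>\<P>. \<forall>k\<le>d. \<exists>!p. p \<in> A \<inter> E k)}"

lemma E_0: "E 0 = {p \<in> P. lv p = 0}"
  by (auto simp: E_def)

lemma E_pos: "0 < k \<Longrightarrow> k \<le> d \<Longrightarrow> E k = insert (piv k) {p \<in> P. lv p = k}"
  by (auto simp: E_def piv_in)

lemma E_subset: "E k \<subseteq> P"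
  by (auto simp: E_def)

lemma finite_E: "finite (E k)"
  using finite_subset[OF E_subset fin] .

lemma card_E: "k \<le> d \<Longrightarrow> card (E k) = r"
proof (cases "k = 0")
  case True
  then show ?thesis by (simp add: E_0 card_level0)
next
  case False
  assume "k \<le> d"
  with False have "piv k \<notin> {p \<in> P. lv p = k}" using lv_piv[of k] by auto
  then show ?thesis using False \<open>k \<le> d\<close> fin r_pos by (simp add: E_pos card_level)
qed

section \<open>Counting transversal partitions\<close>

text \<open>A transversal partition is encoded by the map sending each point to the unique point of
  \<open>E 0\<close> in its part.\<close>

definition labellings :: "nat \<Rightarrow> ('a \<Rightarrow> 'a) set" where
  "labellings n = {g \<in> {p \<in> P. lv p \<le> n} \<rightarrow>\<^sub>E E 0.
     (\<forall>p\<in>E 0. g p = p) \<and> (\<forall>k\<le>n. bij_betw g (E k) (E 0))}"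

text \<open>The ways to extend a labelling to level \<open>k\<close>. Here \<open>e\<close> stands
  for the label of \<open>piv k\<close>, fixed earlier because the pivot has lower level;
  injectivity on \<open>E k\<close> forces the points of level \<open>k\<close> to avoid it.\<close>

definition level_labellings :: "nat \<Rightarrow> 'a \<Rightarrow> ('a \<Rightarrow> 'a) set" where
  "level_labellings k e = {h \<in> {p \<in> P. lv p = k} \<rightarrow>\<^sub>E (E 0 - {e}). inj_on h {p \<in> P. lv p = k}}"

lemma card_level_labellings:
  assumes "0 < k" "k \<le> d" "e \<in> E 0"
  shows "card (level_labellings k e) = fact (r - 1)"
proof -
  have "card (E 0 - {e}) = r - 1" using assms finite_E card_E[of 0] by simp
  then show ?thesis
    using card_inj_on_subset_funcset[of "{p \<in> P. lv p = k}" "E 0 - {e}" "{p \<in> P. lv p = k}"]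
      assms fin finite_E by (simp add: level_labellings_def card_level fact_prod_rev)
qed

lemma finite_labellings: "finite (labellings n)"
proof -
  have "labellings n \<subseteq> {p \<in> P. lv p \<le> n} \<rightarrow>\<^sub>E E 0" by (auto simp: labellings_def)
  then show ?thesis by (rule finite_subset) (auto intro!: finite_PiE simp: fin finite_E)
qed

lemma finite_level_labellings: "finite (level_labellings k e)"
proof -
  have "level_labellings k e \<subseteq> {p \<in> P. lv p = k} \<rightarrow>\<^sub>E (E 0 - {e})"
    by (auto simp: level_labellings_def)
  then show ?thesis by (rule finite_subset) (auto intro!: finite_PiE simp: fin finite_E)
qed

lemma E_level_le: "k \<le> d \<Longrightarrow> p \<in> E k \<Longrightarrow> lv p \<le> k"
  using lv_piv[of k] by (auto simp: E_def)

text \<open>A labelling splits into its restrictions to the levels up to \<open>n\<close> and to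
  level \<open>Suc n\<close>. The first already labels the pivot; the second is an arbitrary
  injection of \<open>r - 1\<close> points into the \<open>r - 1\<close> labels left.\<close>

lemma card_labellings_Suc:
  assumes n: "Suc n \<le> d"
  shows "card (labellings (Suc n)) = card (labellings n) * fact (r - 1)"
proof -
  let ?S = "SIGMA g:labellings n. level_labellings (Suc n) (g (piv (Suc n)))"
  let ?D = "{p \<in> P. lv p = Suc n}" and ?L = "{p \<in> P. lv p \<le> n}" and ?q = "piv (Suc n)"
  let ?f = "\<lambda>g. (restrict g ?L, restrict g ?D)"
  let ?f' = "\<lambda>(g, h). (\<lambda>p. if lv p = Suc n then h p else g p)"
  have q: "?q \<in> ?L" using n piv_in[of "Suc n"] lv_piv[of "Suc n"] by auto
  have ES: "E (Suc n) = insert ?q ?D" using E_pos n by auto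
  have qD: "?q \<notin> ?D" using q by auto
  have EL: "E k \<subseteq> ?L" if "k \<le> n" for k
    using that n E_level_le[of k] E_subset[of k] by fastforce
  have "bij_betw ?f (labellings (Suc n)) ?S"
  proof (rule bij_betw_byWitness[where f' = ?f'])
    show "\<forall>g\<in>labellings (Suc n). ?f' (?f g) = g"
    proof
      fix g assume "g \<in> labellings (Suc n)"
      then have "g \<in> extensional {p \<in> P. lv p \<le> Suc n}" by (auto simp: labellings_def PiE_def)
      then show "?f' (?f g) = g"
        by (auto simp: fun_eq_iff restrict_def extensional_def)
    qed
    show "\<forall>gh\<in>?S. ?f (?f' gh) = gh"
    proof
      fix gh assume "gh \<in> ?S"
      then obtain g h where gh: "gh = (g, h)" "g \<in> extensional ?L" "h \<in> extensional ?D"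
        by (auto simp: labellings_def level_labellings_def PiE_def)
      then show "?f (?f' gh) = gh"
        by (auto simp: fun_eq_iff restrict_def extensional_def)
    qed
    show "?f ` labellings (Suc n) \<subseteq> ?S"
    proof
      fix x assume "x \<in> ?f ` labellings (Suc n)"
      then obtain g where g: "g \<in> labellings (Suc n)" and x: "x = ?f g" by blast
      have m: "g p \<in> E 0" if "p \<in> P" "lv p \<le> Suc n" for p
        using g that by (auto simp: labellings_def)
      have b: "bij_betw g (E k) (E 0)" if "k \<le> Suc n" for k using g that by (auto simp: labellings_def)
      have "restrict g ?L \<in> labellings n"
        unfolding labellings_def
      proof (intro CollectI conjI ballI allI impI)
        show "restrict g ?L \<in> ?L \<rightarrow>\<^sub>E E 0" using m by auto
        show "restrict g ?L p = p" if "p \<in> E 0" for p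
          using that EL[of 0] g by (auto simp: labellings_def)
        show "bij_betw (restrict g ?L) (E k) (E 0)" if "k \<le> n" for k
        proof -
          have "bij_betw (restrict g ?L) (E k) (E 0) = bij_betw g (E k) (E 0)"
            using EL[OF that] by (intro bij_betw_cong) auto
          then show ?thesis using b that by simp
        qed
      qed
      moreover have "restrict g ?D \<in> level_labellings (Suc n) (g ?q)"
      proof -
        have i: "inj_on g (insert ?q ?D)" using b[of "Suc n"] ES by (simp add: bij_betw_def)
        then have "inj_on g ?D" "g p \<noteq> g ?q" if "p \<in> ?D" for p
          using that qD by (auto simp: inj_on_def)
        moreover have "inj_on g ?D" using i by (auto simp: inj_on_def)
        ultimately show ?thesis using m by (auto simp: level_labellings_def inj_on_def)
      qed
      ultimately show "x \<in> ?S" using q x by auto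
    qed
    show "?f' ` ?S \<subseteq> labellings (Suc n)"
    proof
      fix x assume "x \<in> ?f' ` ?S"
      then obtain g h where g: "g \<in> labellings n" and h: "h \<in> level_labellings (Suc n) (g ?q)"
        and x: "x = ?f' (g, h)" by auto
      have gm: "g p \<in> E 0" if "p \<in> ?L" for p using g that by (auto simp: labellings_def)
      have hm: "h p \<in> E 0" "h p \<noteq> g ?q" if "p \<in> ?D" for p
        using h that by (auto simp: level_labellings_def)
      show "x \<in> labellings (Suc n)"
        unfolding labellings_def
      proof (intro CollectI conjI ballI allI impI)
        show "x \<in> {p \<in> P. lv p \<le> Suc n} \<rightarrow>\<^sub>E E 0"
        proof
          fix p assume "p \<in> {p \<in> P. lv p \<le> Suc n}"
          then show "x p \<in> E 0" using gm hm(1) x by (cases "lv p = Suc n") auto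
        next
          fix p assume "p \<notin> {p \<in> P. lv p \<le> Suc n}"
          then show "x p = undefined" using x g h
            by (auto simp: labellings_def level_labellings_def PiE_def extensional_def)
        qed
        show "x p = p" if "p \<in> E 0" for p
          using that g x by (auto simp: labellings_def E_0)
        show "bij_betw x (E k) (E 0)" if k: "k \<le> Suc n" for k
        proof (cases "k = Suc n")
          case False
          with k have "k \<le> n" by simp
          have "bij_betw x (E k) (E 0) = bij_betw g (E k) (E 0)"
            using EL[OF \<open>k \<le> n\<close>] x by (intro bij_betw_cong) auto
          then show ?thesis using g \<open>k \<le> n\<close> by (simp add: labellings_def)
        next
          case True
          have xD: "x p = h p" if "p \<in> ?D" for p using that x by auto
          have xq: "x ?q = g ?q" using q x by auto
          have "inj_on x (E k)"
            using True h hm(2) xD xq by (auto simp: ES inj_on_def level_labellings_def)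
          moreover have "x ` E k \<subseteq> E 0" using True gm[OF q] hm(1) xD xq by (auto simp: ES)
          \<comment> \<open>Both sets have \<open>r\<close> elements, so injectivity into
            \<open>E 0\<close> already gives surjectivity.\<close>
          moreover have "card (E k) = card (E 0)" using n k by (simp add: card_E)
          ultimately show ?thesis
            by (metis bij_betw_def card_image card_subset_eq finite_E)
        qed
      qed
    qed
  qed
  then have "card (labellings (Suc n)) = card ?S" by (rule bij_betw_same_card)
  also have "\<dots> = (\<Sum>g\<in>labellings n. card (level_labellings (Suc n) (g ?q)))"
    using finite_labellings finite_level_labellings by simp
  also have "\<dots> = (\<Sum>g\<in>labellings n. fact (r - 1))"
    using n q by (intro sum.cong refl card_level_labellings) (auto simp: labellings_def)
  finally show ?thesis by simp
qed

lemma card_labellings: "n \<le> d \<Longrightarrow> card (labellings n) = fact (r - 1) ^ n"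
proof (induction n)
  case 0
  have "labellings 0 = {restrict id (E 0)}"
  proof
    show "labellings 0 \<subseteq> {restrict id (E 0)}"
      by (auto simp: labellings_def E_0 fun_eq_iff PiE_def extensional_def)
    have "bij_betw (restrict id (E 0)) (E 0) (E 0)" by (simp add: bij_betw_def inj_on_def)
    then show "{restrict id (E 0)} \<subseteq> labellings 0" by (auto simp: labellings_def E_0)
  qed
  then show ?case by simp
next
  case (Suc n)
  then show ?case using card_labellings_Suc[of n] by simp
qed

text \<open>The parts are the fibres of a labelling, and bijectivity on \<open>E k\<close> says that
  each fibre meets \<open>E k\<close> exactly once. Conversely, a point is labelled by the
  representative of its part in \<open>E 0\<close>.\<close>

lemma card_transversal_partitions: "card transversal_partitions = fact (r - 1) ^ d"
proof -
  let ?f = "\<lambda>g. (\<lambda>e. {p \<in> P. g p = e}) ` E 0"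
  have Pd: "{p \<in> P. lv p \<le> d} = P" using lv_le by auto
  have lab: "g \<in> P \<rightarrow>\<^sub>E E 0" "\<And>p. p \<in> E 0 \<Longrightarrow> g p = p" "\<And>k. k \<le> d \<Longrightarrow> bij_betw g (E k) (E 0)"
    if "g \<in> labellings d" for g using that Pd by (auto simp: labellings_def)
  have "bij_betw ?f (labellings d) transversal_partitions"
  proof (rule bij_betw_imageI)
    show "inj_on ?f (labellings d)"
    proof
      fix g h assume g: "g \<in> labellings d" and h: "h \<in> labellings d" and eq: "?f g = ?f h"
      have "g p = h p" if p: "p \<in> P" for p
      proof -
        have gp: "g p \<in> E 0" using lab(1)[OF g] p by auto
        then have "{p' \<in> P. g p' = g p} \<in> ?f h" using eq by blast
        then obtain e where e: "{p' \<in> P. g p' = g p} = {p' \<in> P. h p' = e}" by blast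
        \<comment> \<open>Labels are fixed points, so the common fibre contains \<open>g p\<close>;
          hence it is also the fibre of \<open>h\<close> over \<open>g p\<close>.\<close>
        have "g (g p) = g p" and hg: "h (g p) = g p" using lab(2) g h gp by auto
        then have "g p \<in> {p' \<in> P. g p' = g p}" "p \<in> {p' \<in> P. g p' = g p}"
          using gp E_subset p by auto
        then show ?thesis using hg unfolding e by simp
      qed
      then show "g = h" using lab(1)[OF g] lab(1)[OF h] by (auto intro: PiE_ext)
    qed
    show "?f ` labellings d = transversal_partitions"
    proof (intro equalityI subsetI)
      fix \<P> assume "\<P> \<in> ?f ` labellings d"
      then obtain g where g: "g \<in> labellings d" and \<P>: "\<P> = ?f g" by blast
      have "partition_on P \<P>"
      proof (rule partition_onI)
        show "\<Union> \<P> = P" using lab(1)[OF g] \<P> by auto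
        show "\<And>A B. A \<in> \<P> \<Longrightarrow> B \<in> \<P> \<Longrightarrow> A \<noteq> B \<Longrightarrow> disjnt A B" using \<P> by (auto simp: disjnt_def)
        have "\<exists>p. p \<in> P \<and> g p = e" if "e \<in> E 0" for e using that lab(2)[OF g] E_subset by blast
        then show "{} \<notin> \<P>" using \<P> by auto
      qed
      moreover have "\<exists>!p. p \<in> A \<inter> E k" if A: "A \<in> \<P>" and k: "k \<le> d" for A k
      proof -
        obtain e where e: "e \<in> E 0" "A = {p \<in> P. g p = e}" using A \<P> by blast
        have "inj_on g (E k)" "e \<in> g ` E k" using lab(3)[OF g k] e(1) by (auto simp: bij_betw_def)
        then have "\<exists>!p. p \<in> E k \<and> g p = e" by (auto simp: inj_on_def)
        then show ?thesis using e(2) E_subset[of k] by blast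
      qed
      ultimately show "\<P> \<in> transversal_partitions" by (simp add: transversal_partitions_def)
    next
      fix \<P> assume "\<P> \<in> transversal_partitions"
      then have part: "partition_on P \<P>" and tr: "\<And>A k. A \<in> \<P> \<Longrightarrow> k \<le> d \<Longrightarrow> \<exists>!p. p \<in> A \<inter> E k"
        by (auto simp: transversal_partitions_def)
      define rep where "rep A = (THE p. p \<in> A \<inter> E 0)" for A
      have rep: "rep A \<in> A" "rep A \<in> E 0" "\<And>p. p \<in> A \<Longrightarrow> p \<in> E 0 \<Longrightarrow> p = rep A" if "A \<in> \<P>" for A
      proof -
        have ex: "\<exists>!p. p \<in> A \<inter> E 0" using tr[OF that] by simp
        then have "rep A \<in> A \<inter> E 0" unfolding rep_def by (rule theI')
        then show "rep A \<in> A" "rep A \<in> E 0" "\<And>p. p \<in> A \<Longrightarrow> p \<in> E 0 \<Longrightarrow> p = rep A" using ex by auto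
      qed
      define part_of where "part_of p = (THE A. A \<in> \<P> \<and> p \<in> A)" for p
      have part_of: "part_of p = A" if "A \<in> \<P>" "p \<in> A" for p A
        unfolding part_of_def using that partition_onD2[OF part]
        by (intro the_equality) (auto simp: disjoint_def)
      have ex_part: "\<exists>A\<in>\<P>. p \<in> A" if "p \<in> P" for p using that partition_onD1[OF part] by auto
      define g where "g = (\<lambda>p\<in>P. rep (part_of p))"
      have AP: "A \<subseteq> P" if "A \<in> \<P>" for A using that partition_onD1[OF part] by auto
      have g: "g p = rep A" if "A \<in> \<P>" "p \<in> A" for p A
        using that AP part_of by (auto simp: g_def)
      have rep_inj: "A = B" if "A \<in> \<P>" "B \<in> \<P>" "rep A = rep B" for A B
      proof -
        have "rep A \<in> A" "rep A \<in> B" using rep(1)[OF that(1)] rep(1)[OF that(2)] that(3) by simp_all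
        then have "part_of (rep A) = A" "part_of (rep A) = B"
          using part_of[OF that(1)] part_of[OF that(2)] by blast+
        then show ?thesis by (rule subst)
      qed
      have "g \<in> labellings d"
        unfolding labellings_def Pd
      proof (intro CollectI conjI ballI allI impI)
        show "g \<in> P \<rightarrow>\<^sub>E E 0"
        proof
          show "g p \<in> E 0" if "p \<in> P" for p using ex_part[OF that] g rep(2) by metis
        qed (simp add: g_def)
        show "g p = p" if "p \<in> E 0" for p
          using ex_part[of p] g rep(3) that E_subset by (metis subsetD)
        show "bij_betw g (E k) (E 0)" if k: "k \<le> d" for k
        proof (rule bij_betw_imageI)
          show "inj_on g (E k)"
          proof
            fix p p' assume p: "p \<in> E k" "p' \<in> E k" "g p = g p'"
            then obtain A B where AB: "A \<in> \<P>" "p \<in> A" "B \<in> \<P>" "p' \<in> B"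
              using ex_part E_subset by (meson subsetD)
            then have "A = B" using g p(3) rep_inj by metis
            then show "p = p'" using tr[OF AB(1) k] AB p by blast
          qed
          show "g ` E k = E 0"
          proof (intro equalityI subsetI)
            fix e assume "e \<in> g ` E k"
            then obtain p where "p \<in> E k" "e = g p" by auto
            then show "e \<in> E 0" using ex_part[of p] g rep(2) E_subset by (metis subsetD)
          next
            fix e assume e: "e \<in> E 0"
            then obtain A where A: "A \<in> \<P>" "e \<in> A" using ex_part E_subset by (meson subsetD)
            then obtain p where "p \<in> A" "p \<in> E k" using tr[OF A(1) k] by blast
            then have "g p = e" using g A rep(3) e by metis
            then show "e \<in> g ` E k" using \<open>p \<in> E k\<close> by blast
          qed
        qed
      qed
      moreover have fib: "{p \<in> P. g p = rep A} = A" if A: "A \<in> \<P>" for A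
      proof (intro equalityI subsetI)
        fix p assume "p \<in> {p \<in> P. g p = rep A}"
        then obtain B where B: "B \<in> \<P>" "p \<in> B" "g p = rep A" using ex_part by blast
        then have "rep B = rep A" using g by simp
        then show "p \<in> A" using rep_inj A B by blast
      qed (use g[OF A] AP[OF A] in auto)
      moreover have "\<P> = ?f g"
      proof -
        have "e \<in> rep ` \<P>" if e: "e \<in> E 0" for e
        proof -
          obtain A where "A \<in> \<P>" "e \<in> A" using e ex_part E_subset by blast
          then show ?thesis using rep(3) e by blast
        qed
        then have "E 0 = rep ` \<P>" using rep(2) by blast
        then have "?f g = (\<lambda>A. {p \<in> P. g p = rep A}) ` \<P>" by (simp only: image_image)
        also have "\<dots> = (\<lambda>A. A) ` \<P>" using fib by (intro image_cong) auto
        finally show ?thesis by simp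
      qed
      ultimately show "\<P> \<in> ?f ` labellings d" by blast
    qed
  qed
  then show ?thesis using card_labellings[of d] bij_betw_same_card by fastforce
qed

text \<open>Transversality does not mention the number of parts; it is recovered from the bijection
  sending each part to its point of \<open>E 0\<close>.\<close>

lemma transversal_card:
  assumes "partition_on P \<P>" "\<And>A k. A \<in> \<P> \<Longrightarrow> k \<le> d \<Longrightarrow> \<exists>!p. p \<in> A \<inter> E k"
  shows "card \<P> = r"
proof -
  have "bij_betw (\<lambda>A. THE p. p \<in> A \<inter> E 0) \<P> (E 0)"
  proof (rule bij_betw_imageI)
    show "inj_on (\<lambda>A. THE p. p \<in> A \<inter> E 0) \<P>"
    proof
      fix A B assume AB: "A \<in> \<P>" "B \<in> \<P>"
        and eq: "(THE p. p \<in> A \<inter> E 0) = (THE p. p \<in> B \<inter> E 0)"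
      have "(THE p. p \<in> A \<inter> E 0) \<in> A \<inter> E 0" "(THE p. p \<in> B \<inter> E 0) \<in> B \<inter> E 0"
        using assms(2)[of A 0] assms(2)[of B 0] AB theI'[of "\<lambda>p. p \<in> A \<inter> E 0"]
          theI'[of "\<lambda>p. p \<in> B \<inter> E 0"] by auto
      then have "A \<inter> B \<noteq> {}" using eq by auto
      then show "A = B" using AB partition_onD2[OF assms(1)] by (auto simp: disjoint_def)
    qed
    show "(\<lambda>A. THE p. p \<in> A \<inter> E 0) ` \<P> = E 0"
    proof (intro equalityI subsetI)
      fix e assume "e \<in> (\<lambda>A. THE p. p \<in> A \<inter> E 0) ` \<P>"
      then obtain A where "A \<in> \<P>" "e = (THE p. p \<in> A \<inter> E 0)" by auto
      then show "e \<in> E 0" using assms(2)[of A 0] theI'[of "\<lambda>p. p \<in> A \<inter> E 0"] by auto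
    next
      fix e assume e: "e \<in> E 0"
      then obtain A where A: "A \<in> \<P>" "e \<in> A"
        using E_subset partition_onD1[OF assms(1)] by blast
      then have "(THE p. p \<in> A \<inter> E 0) = e" using e assms(2)[of A 0] by (intro the1_equality) auto
      then show "e \<in> (\<lambda>A. THE p. p \<in> A \<inter> E 0) ` \<P>" using A by blast
    qed
  qed
  then show ?thesis using card_E[of 0] bij_betw_same_card by fastforce
qed

end

section \<open>Tverberg partitions are transversal\<close>

lemma sum_UN_le:
  fixes f :: "'b \<Rightarrow> real"
  assumes "finite I" "\<And>i. i \<in> I \<Longrightarrow> finite (B i)" "\<And>i x. i \<in> I \<Longrightarrow> x \<in> B i \<Longrightarrow> 0 \<le> f x"
  shows "sum f (\<Union>i\<in>I. B i) \<le> (\<Sum>i\<in>I. sum f (B i))"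
proof -
  have "sum f (\<Union>i\<in>I. B i) \<le> (\<Sum>(i, x)\<in>Sigma I B. f x)"
    using assms by (intro sum_le_included[where i = snd]) force+
  also have "\<dots> = (\<Sum>i\<in>I. sum f (B i))" using assms by (simp add: sum.Sigma)
  finally show ?thesis .
qed

text \<open>\<open>w p k\<close> stands for the \<open>k\<close>-th coordinate of \<open>p\<close>.
  The extra coordinate \<open>w p 0 = 1\<close> is homogeneous: index 0 covers the normalization of
  convex combinations and the constant terms of affine functions.\<close>

locale stretched_points = greedy_levels d r P lv piv
  for d r :: nat and P :: "'a set" and lv :: "'a \<Rightarrow> nat" and piv :: "nat \<Rightarrow> 'a" +
  fixes m :: nat and K :: "nat \<Rightarrow> real" and w :: "'a \<Rightarrow> nat \<Rightarrow> real"
  assumes d_pos: "d \<ge> 1" and m_pos: "m \<ge> 1"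
    and K_ge_2: "0 < k \<Longrightarrow> k \<le> d \<Longrightarrow> K k \<ge> 2"
    and K_mono: "0 < i \<Longrightarrow> i < k \<Longrightarrow> k \<le> d \<Longrightarrow> 2 * (real d)^2 * K i ^ m \<le> K k"
    and w_0: "p \<in> P \<Longrightarrow> w p 0 = 1"
    and w_ge_1: "p \<in> P \<Longrightarrow> 0 < k \<Longrightarrow> k \<le> d \<Longrightarrow> 1 \<le> w p k"
    and w_le: "p \<in> P \<Longrightarrow> 0 < k \<Longrightarrow> k \<le> d \<Longrightarrow> w p k \<le> K k ^ (m - 1)"
    and w_inj: "p \<in> P \<Longrightarrow> q \<in> P \<Longrightarrow> 0 < k \<Longrightarrow> k \<le> d \<Longrightarrow> w p k = w q k \<Longrightarrow> p = q"
    and w_gap: "p \<in> P \<Longrightarrow> q \<in> P \<Longrightarrow> 0 < k \<Longrightarrow> k \<le> d \<Longrightarrow> w p k < w q k \<Longrightarrow>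
      K k ^ (2 * d + 3) * w p k \<le> w q k"
    and above_piv: "p \<in> P \<Longrightarrow> 0 < k \<Longrightarrow> k \<le> d \<Longrightarrow> lv p = k \<Longrightarrow> w (piv k) k < w p k"
    and below_piv: "p \<in> P \<Longrightarrow> 0 < k \<Longrightarrow> k \<le> d \<Longrightarrow> lv p < k \<Longrightarrow> w p k \<le> w (piv k) k"
begin

lemma w_pos: "p \<in> P \<Longrightarrow> k \<le> d \<Longrightarrow> 0 < w p k"
  using w_0[of p] w_ge_1[of p k] by (cases "k = 0") auto

section \<open>Near-top points in each part\<close>

text \<open>By \<open>K_mono\<close> and \<open>K i \<ge> 2\<close>, each term is at most 1 / (4d),
  and there are at most \<open>d\<close> terms.\<close>

lemma sum_ratio_le:
  assumes i: "0 < i"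
  shows "(\<Sum>k\<in>{i<..d}. K i ^ (m - 1) / K k) \<le> 1 / 4"
proof (cases "i < d")
  case False
  then show ?thesis by simp
next
  case True
  have Ki: "K i \<ge> 2" using i True K_ge_2 by simp
  have d: "real d \<ge> 1" using d_pos by simp
  have "K i ^ (m - 1) / K k \<le> 1 / (4 * d)" if "k \<in> {i<..d}" for k
  proof -
    have Kk: "K k \<ge> 2" using that i K_ge_2 by simp
    have "4 * real d * K i ^ (m - 1) \<le> 2 * real d * (real d * (K i * K i ^ (m - 1)))"
    proof -
      have "1 * (2 * K i ^ (m - 1)) \<le> real d * (K i * K i ^ (m - 1))"
        using Ki d by (intro mult_mono) auto
      then have "2 * real d * (1 * (2 * K i ^ (m - 1))) \<le> 2 * real d * (real d * (K i * K i ^ (m - 1)))"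
        by (intro mult_left_mono) auto
      then show ?thesis by (simp add: mult_ac)
    qed
    also have "\<dots> = 2 * (real d)^2 * K i ^ m"
      using m_pos by (cases m) (simp_all add: power2_eq_square)
    also have "\<dots> \<le> K k" using that i K_mono by simp
    finally show ?thesis using Kk d by (simp add: field_simps)
  qed
  then have "(\<Sum>k\<in>{i<..d}. K i ^ (m - 1) / K k) \<le> of_nat (card {i<..d}) * (1 / (4 * d))"
    by (rule sum_bounded_above)
  also have "\<dots> \<le> real d * (1 / (4 * d))" using d by (intro mult_right_mono) auto
  also have "\<dots> = 1 / 4" using d by simp
  finally show ?thesis .
qed

text \<open>The first term is at most 1/2, and \<open>sum_ratio_le\<close> for \<open>i = 1\<close>
  bounds the rest by 1/4.\<close>

lemma sum_inverse_K_le: "(\<Sum>k\<in>{0<..d}. 1 / K k) \<le> 3 / 4"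
proof -
  have d: "real d \<ge> 1" using d_pos by simp
  have K1: "K 1 \<ge> 2" using K_ge_2 d_pos by simp
  have "1 / K k \<le> K 1 ^ (m - 1) / K k" if "k \<in> {1<..d}" for k
    using K1 K_ge_2[of k] that by (intro divide_right_mono one_le_power) auto
  then have "(\<Sum>k\<in>{1<..d}. 1 / K k) \<le> (\<Sum>k\<in>{1<..d}. K 1 ^ (m - 1) / K k)" by (rule sum_mono)
  also have "\<dots> \<le> 1 / 4" by (rule sum_ratio_le) simp
  finally have "(\<Sum>k\<in>{1<..d}. 1 / K k) \<le> 1 / 4" .
  moreover have "{0<..d} = insert 1 {1<..d}" using d_pos by auto
  moreover have "1 / K 1 \<le> 1 / 2" using K1 by (intro divide_left_mono) auto
  ultimately show ?thesis by simp
qed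

text \<open>Here \<open>x\<close> holds the coordinates of a common point. The factor 4 allows for
  the points violating the second condition, which may carry up to 3/4 of coordinate
  \<open>k\<close>.\<close>

definition near_top :: "(nat \<Rightarrow> real) \<Rightarrow> nat \<Rightarrow> 'a \<Rightarrow> bool" where
  "near_top x k p \<longleftrightarrow> x k \<le> 4 * w p k \<and> (\<forall>i\<in>{k<..d}. w p i \<le> K i * x i)"

text \<open>Markov's inequality for the weights: the points exceeding \<open>x\<close> by the factor \<open>K k\<close> in some
  direction \<open>k > i\<close> carry so little weight that they cannot produce coordinate \<open>i\<close>.\<close>

lemma ex_near_top:
  assumes A: "A \<subseteq> P" and u: "\<And>p. p \<in> A \<Longrightarrow> 0 \<le> u p"
    and x: "\<And>k. k \<le> d \<Longrightarrow> (\<Sum>p\<in>A. u p * w p k) = x k" and x0: "x 0 = 1" and i: "i \<le> d"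
  shows "\<exists>p\<in>A. near_top x i p"
proof (rule ccontr)
  assume none: "\<not> ?thesis"
  have finA: "finite A" using A fin finite_subset by blast
  have su: "(\<Sum>p\<in>A. u p) = 1"
    using x[of 0] x0 A w_0 by (simp add: subset_iff cong: sum.cong)
  have x_ge_1: "x k \<ge> 1" if "k \<le> d" for k
  proof (cases "k = 0")
    case False
    have "(\<Sum>p\<in>A. u p * 1) \<le> (\<Sum>p\<in>A. u p * w p k)"
      using u A w_ge_1[of _ k] that False by (intro sum_mono mult_left_mono) auto
    then show ?thesis using su x[OF that] by simp
  qed (simp add: x0)
  define bad where "bad k = {p \<in> A. K k * x k < w p k}" for k
  \<comment> \<open>A bound for coordinate \<open>i\<close> on the box. In the homogeneous direction
    it is 1, which is why \<open>i = 0\<close> needs \<open>sum_inverse_K_le\<close> in place of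
    \<open>sum_ratio_le\<close>.\<close>
  define B where "B = (if i = 0 then 1 else K i ^ (m - 1))"
  have wB: "w p i \<le> B" "0 < w p i" if "p \<in> A" for p
    using that A w_le[of p i] w_0[of p] w_pos[of p i] i by (auto simp: B_def)
  have B0: "B \<ge> 0" using K_ge_2[of i] i by (cases "i = 0") (auto simp: B_def)
  have markov: "(\<Sum>p\<in>bad k. u p) \<le> 1 / K k" if k: "k \<in> {i<..d}" for k
  proof -
    have Kk: "K k \<ge> 2" using k K_ge_2 by simp
    have "(K k * x k) * (\<Sum>p\<in>bad k. u p) = (\<Sum>p\<in>bad k. u p * (K k * x k))"
      by (simp add: sum_distrib_right mult.commute)
    also have "\<dots> \<le> (\<Sum>p\<in>bad k. u p * w p k)"
      using u by (intro sum_mono mult_left_mono) (auto simp: bad_def)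
    also have "\<dots> \<le> (\<Sum>p\<in>A. u p * w p k)"
      using u finA A w_pos[of _ k, THEN less_imp_le] k
      by (intro sum_mono2) (auto simp: bad_def intro!: mult_nonneg_nonneg)
    also have "\<dots> = x k" using x k by simp
    finally have "x k * (K k * (\<Sum>p\<in>bad k. u p)) \<le> x k * 1" by (simp add: mult_ac)
    then have "K k * (\<Sum>p\<in>bad k. u p) \<le> 1" using x_ge_1[of k] k by simp
    then show ?thesis using Kk by (simp add: field_simps)
  qed
  let ?bad = "\<Union>k\<in>{i<..d}. bad k"
  have sub: "?bad \<subseteq> A" by (auto simp: bad_def)
  have B34: "(\<Sum>k\<in>{i<..d}. B / K k) \<le> 3 / 4"
    using sum_ratio_le[of i] sum_inverse_K_le by (cases "i = 0") (auto simp: B_def)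
  have "(\<Sum>p\<in>?bad. u p * w p i) \<le> (\<Sum>p\<in>?bad. u p * B)"
    using u wB sub by (intro sum_mono mult_left_mono) auto
  also have "\<dots> = (\<Sum>p\<in>?bad. u p) * B" by (simp add: sum_distrib_right)
  also have "\<dots> \<le> (\<Sum>k\<in>{i<..d}. \<Sum>p\<in>bad k. u p) * B"
  proof (rule mult_right_mono[OF _ B0])
    show "sum u ?bad \<le> (\<Sum>k\<in>{i<..d}. sum u (bad k))"
      using finA u by (intro sum_UN_le) (auto simp: bad_def)
  qed
  also have "\<dots> \<le> (\<Sum>k\<in>{i<..d}. 1 / K k) * B"
    by (intro mult_right_mono sum_mono markov B0) auto
  also have "\<dots> = (\<Sum>k\<in>{i<..d}. B / K k)" by (simp add: sum_distrib_right)
  finally have "(\<Sum>p\<in>?bad. u p * w p i) \<le> 3 / 4" using B34 by simp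
  also have "\<dots> \<le> 3 / 4 * x i" using x_ge_1[OF i] by simp
  finally have bad_le: "(\<Sum>p\<in>?bad. u p * w p i) \<le> 3 / 4 * x i" .
  have split: "(\<Sum>p\<in>A. u p * w p i) = (\<Sum>p\<in>A - ?bad. u p * w p i) + (\<Sum>p\<in>?bad. u p * w p i)"
    using finA sub by (simp add: sum.subset_diff)
  then have good: "x i / 4 \<le> (\<Sum>p\<in>A - ?bad. u p * w p i)" using bad_le x[OF i] by simp
  have small: "4 * w p i < x i" if "p \<in> A - ?bad" for p
  proof -
    have "\<not> near_top x i p" "p \<in> A" using that none by auto
    moreover have "\<forall>k\<in>{i<..d}. w p k \<le> K k * x k" using that by (auto simp: bad_def)
    ultimately show ?thesis by (auto simp: near_top_def)
  qed
  have "(\<Sum>p\<in>A - ?bad. u p * w p i) < x i / 4"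
  \<comment> \<open>Strictness needs a good point with positive coefficient. Without one the sum is
    0, still below \<open>x i / 4\<close> because \<open>x i \<ge> 1\<close>.\<close>
  proof (cases "\<exists>p\<in>A - ?bad. u p \<noteq> 0")
    case False
    then have "(\<Sum>p\<in>A - ?bad. u p * w p i) = 0" by simp
    then show ?thesis using x_ge_1[OF i] by simp
  next
    case True
    then obtain p0 where p0: "p0 \<in> A - ?bad" "u p0 > 0" using u by (metis DiffD1 order_le_less)
    have "(\<Sum>p\<in>A - ?bad. u p * w p i) < (\<Sum>p\<in>A - ?bad. u p * (x i / 4))"
    proof (rule sum_strict_mono_ex1)
      show "\<forall>p\<in>A - ?bad. u p * w p i \<le> u p * (x i / 4)"
      proof
        fix p assume p: "p \<in> A - ?bad"
        then have "w p i \<le> x i / 4" "0 \<le> u p" using small[OF p] u by auto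
        then show "u p * w p i \<le> u p * (x i / 4)" by (rule mult_left_mono)
      qed
      have "u p0 * w p0 i < u p0 * (x i / 4)"
        using p0(2) small[OF p0(1)] by (intro mult_strict_left_mono) auto
      then show "\<exists>p\<in>A - ?bad. u p * w p i < u p * (x i / 4)" using p0(1) by blast
    qed (use finA in auto)
    also have "\<dots> = (\<Sum>p\<in>A - ?bad. u p) * (x i / 4)" by (simp only: sum_distrib_right)
    also have "\<dots> \<le> 1 * (x i / 4)"
      using su sum_mono2[of A "A - ?bad" u] finA u x_ge_1[OF i] by (intro mult_right_mono) auto
    finally show ?thesis by simp
  qed
  then show False using good by simp
qed

text \<open>Each part contains a near-top point for \<open>k\<close>, and parts are disjoint, so
  \<open>T k\<close> has at least \<open>r\<close> elements. A descending induction gives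
  \<open>S k \<subseteq> L k\<close>; an ascending one then squeezes \<open>T k\<close> into
  \<open>E k\<close>, which has just \<open>r\<close> elements. So each part receives exactly one of
  them.\<close>

lemma transversal_of_common_point:
  assumes part: "partition_on P \<P>" and card: "card \<P> = r"
    and u: "\<And>A p. A \<in> \<P> \<Longrightarrow> p \<in> A \<Longrightarrow> 0 \<le> u A p"
    and x: "\<And>A k. A \<in> \<P> \<Longrightarrow> k \<le> d \<Longrightarrow> (\<Sum>p\<in>A. u A p * w p k) = x k" and x0: "x 0 = 1"
    and A: "A \<in> \<P>" and k: "k \<le> d"
  shows "\<exists>!p. p \<in> A \<inter> E k"
proof -
  have AP: "A \<subseteq> P" if "A \<in> \<P>" for A using that partition_onD1[OF part] by auto
  define S where "S k = {p \<in> P. \<forall>i\<in>{k<..d}. w p i \<le> K i * x i}" for k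
  define T where "T k = {p \<in> P. near_top x k p}" for k
  have finS: "finite (S k)" "finite (T k)" for k using fin by (auto simp: S_def T_def)
  have same_part: "A = B" if "A \<in> \<P>" "B \<in> \<P>" "p \<in> A" "p \<in> B" for A B p
    using that partition_onD2[OF part] by (auto simp: disjoint_def)
  have ex: "\<exists>p\<in>A. p \<in> T k" if A: "A \<in> \<P>" and k: "k \<le> d" for A k
  proof -
    have "\<exists>p\<in>A. near_top x k p"
      using AP[OF A] u[OF A] x[OF A] x0 k by (rule ex_near_top)
    then show ?thesis using AP[OF A] by (auto simp: T_def)
  qed
  have pigeon: "\<exists>f. (\<forall>A\<in>\<P>. f A \<in> A \<inter> X) \<and> inj_on f \<P>"
    if X: "\<And>A. A \<in> \<P> \<Longrightarrow> \<exists>p\<in>A. p \<in> X" for X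
  proof -
    obtain f where f: "\<forall>A\<in>\<P>. f A \<in> A \<inter> X" using X by (metis IntI)
    moreover have "inj_on f \<P>"
    proof
      fix A B assume "A \<in> \<P>" "B \<in> \<P>" "f A = f B"
      then show "A = B" using f same_part[of A B "f A"] by (metis IntD1)
    qed
    ultimately show ?thesis by blast
  qed
  have cardT: "r \<le> card (T k)" if k: "k \<le> d" for k
  proof -
    obtain f where "\<forall>A\<in>\<P>. f A \<in> A \<inter> T k" "inj_on f \<P>" using pigeon[of "T k"] ex[OF _ k] by blast
    then show ?thesis using card card_inj_on_le[of f \<P> "T k"] finS by auto
  qed
  have x_ge_1: "x k \<ge> 1" if "k \<le> d" for k
  proof (cases "k = 0")
    case False
    have su: "(\<Sum>p\<in>A. u A p) = 1"
      using x[of A 0] A x0 AP[OF A] w_0 by (simp add: subset_iff cong: sum.cong)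
    have "(\<Sum>p\<in>A. u A p * 1) \<le> (\<Sum>p\<in>A. u A p * w p k)"
      using u[OF A] AP[OF A] w_ge_1[of _ k] that False by (intro sum_mono mult_left_mono) auto
    then show ?thesis using su x[OF A that] by simp
  qed (simp add: x0)
  have K5: "K k ^ 5 \<le> K k ^ (2 * d + 3)" if "0 < k" "k \<le> d" for k
    using K_ge_2[OF that] d_pos by (intro power_increasing) auto
  \<comment> \<open>\<open>K k \<ge> 2\<close> gives \<open>4 * K k < K k ^ 5\<close>, and
    \<open>d \<ge> 1\<close> makes 5 at most \<open>2 * d + 3\<close>.\<close>
  have gap: "4 * K k * w p k < w q k" if "0 < k" "k \<le> d" "p \<in> P" "q \<in> P" "w p k < w q k" for k p q
  proof -
    have K2: "K k \<ge> 2" using K_ge_2 that by simp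
    have "2 ^ 4 * K k \<le> K k ^ 4 * K k" using K2 by (intro mult_right_mono power_mono) auto
    then have "4 * K k < K k ^ 5" using K2 by (simp add: eval_nat_numeral)
    then have "4 * K k < K k ^ (2 * d + 3)" using K5[OF that(1,2)] by linarith
    then have "4 * K k * w p k < K k ^ (2 * d + 3) * w p k"
      using w_pos[OF that(3,2)] by (rule mult_strict_right_mono)
    also have "\<dots> \<le> w q k" using w_gap[OF that(3,4,1,2,5)] .
    finally show ?thesis .
  qed
  have TS: "T k \<subseteq> S k" for k by (auto simp: T_def S_def near_top_def)
  have S_step: "p \<in> S k \<longleftrightarrow> p \<in> S (Suc k) \<and> w p (Suc k) \<le> K (Suc k) * x (Suc k)"
    if "Suc k \<le> d" for k p
  proof -
    have "{k<..d} = insert (Suc k) {Suc k<..d}" using that by auto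
    then show ?thesis by (auto simp: S_def)
  qed
  define L where "L k = {p \<in> P. lv p \<le> k}" for k
  have pivL: "piv (Suc k) \<in> L k" if "Suc k \<le> d" for k
    using that piv_in[of "Suc k"] lv_piv[of "Suc k"] by (auto simp: L_def)
  text \<open>If all points of \<open>S k\<close> have level at most \<open>k\<close>, then the pivot is at least as high as the
    lowest of the \<open>r\<close> near-top points, so all points of level \<open>k\<close> lie far above \<open>x\<close>.\<close>
  have level_large: "K (Suc k) * x (Suc k) < w p (Suc k)"
    if k: "Suc k \<le> d" and SL: "S (Suc k) \<subseteq> L (Suc k)" and p: "p \<in> P" "lv p = Suc k" for k p
  proof -
    have "\<exists>p\<in>T (Suc k). lv p < Suc k"
    proof (rule ccontr)
      assume "\<not> ?thesis"
      then have low: "\<not> lv p < Suc k" if "p \<in> T (Suc k)" for p using that by blast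
      have "T (Suc k) \<subseteq> {p \<in> P. lv p = Suc k}"
      proof
        fix p assume p: "p \<in> T (Suc k)"
        then have "p \<in> P" "lv p \<le> Suc k" using TS SL unfolding L_def by blast+
        then show "p \<in> {p \<in> P. lv p = Suc k}" using low[OF p] by simp
      qed
      then have "card (T (Suc k)) \<le> card {p \<in> P. lv p = Suc k}" using fin by (intro card_mono) auto
      then have "card (T (Suc k)) \<le> r - 1" using card_level[of "Suc k"] k by simp
      then show False using cardT[OF k] r_pos by simp
    qed
    then obtain t where t: "t \<in> P" "x (Suc k) \<le> 4 * w t (Suc k)" "lv t < Suc k"
      by (auto simp: T_def near_top_def)
    then have "x (Suc k) \<le> 4 * w (piv (Suc k)) (Suc k)" using below_piv[of t "Suc k"] k by simp
    then have "K (Suc k) * x (Suc k) \<le> 4 * K (Suc k) * w (piv (Suc k)) (Suc k)"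
      using K_ge_2[of "Suc k"] k by simp
    also have "\<dots> < w p (Suc k)"
      using gap[of "Suc k" "piv (Suc k)" p] above_piv[of p "Suc k"] piv_in[of "Suc k"] p k by simp
    finally show ?thesis .
  qed
  \<comment> \<open>Passing from \<open>Suc n\<close> down to \<open>n\<close> imposes one more
    bound, and by \<open>level_large\<close> this excludes every point of level
    \<open>Suc n\<close>.\<close>
  have SL: "S k \<subseteq> L k" if "k \<le> d" for k
    using that
  proof (induction k rule: inc_induct)
    case base
    show ?case using lv_le by (auto simp: S_def L_def)
  next
    case (step n)
    show ?case
    proof
      fix p assume p: "p \<in> S n"
      then have *: "p \<in> S (Suc n)" "w p (Suc n) \<le> K (Suc n) * x (Suc n)" using S_step step by auto
      then have "p \<in> L (Suc n)" using step by blast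
      then have pP: "p \<in> P" "lv p \<le> Suc n" by (auto simp: L_def)
      have "\<not> K (Suc n) * x (Suc n) < w p (Suc n)" using *(2) by simp
      then have "lv p \<noteq> Suc n" using level_large[of n p] step pP(1) by auto
      then show "p \<in> L n" using pP by (simp add: L_def)
    qed
  qed
  have "T k = E k \<and> S k = L k" if "k \<le> d" for k
    using that
  proof (induction k)
    case 0
    have "T 0 \<subseteq> S 0" "S 0 \<subseteq> L 0" "L 0 = E 0" using TS SL by (auto simp: L_def E_0)
    moreover have "T 0 = E 0"
      using calculation card_E[of 0] cardT[of 0] finite_E by (intro card_seteq) auto
    ultimately show ?case by auto
  next
    case (Suc n)
    then have IH: "S n = L n" and n: "Suc n \<le> d" by auto
    have "T (Suc n) \<subseteq> E (Suc n)"
    proof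
      fix p assume p: "p \<in> T (Suc n)"
      then have pP: "p \<in> P" "p \<in> S (Suc n)" "x (Suc n) \<le> 4 * w p (Suc n)" using TS
        by (auto simp: T_def near_top_def)
      show "p \<in> E (Suc n)"
      proof (cases "lv p = Suc n")
        case False
        moreover have "lv p \<le> Suc n" using SL[OF n] pP(2) unfolding L_def by blast
        ultimately have pL: "p \<in> L n" using pP(1) by (simp add: L_def)
        have le: "w p (Suc n) \<le> w (piv (Suc n)) (Suc n)"
          using below_piv[of p "Suc n"] pP n pL by (auto simp: L_def)
        \<comment> \<open>The pivot lies in \<open>L n\<close>, which equals \<open>S n\<close>, so
          it exceeds \<open>p\<close> by at most the factor \<open>4 * K (Suc n)\<close>. By
          \<open>gap\<close> it is then not higher than \<open>p\<close> at all, and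
          \<open>below_piv\<close> excludes that it is lower.\<close>
        have "w (piv (Suc n)) (Suc n) \<le> K (Suc n) * x (Suc n)"
          using pivL[OF n] IH S_step[OF n] by blast
        also have "\<dots> \<le> 4 * K (Suc n) * w p (Suc n)" using K_ge_2[of "Suc n"] n pP(3) by simp
        finally have "\<not> w p (Suc n) < w (piv (Suc n)) (Suc n)"
          using gap[of "Suc n" p "piv (Suc n)"] n pP piv_in[of "Suc n"] by auto
        then have "p = piv (Suc n)"
          using le w_inj[of p "piv (Suc n)" "Suc n"] pP n piv_in[of "Suc n"] by simp
        then show ?thesis using E_pos n by auto
      qed (use pP in \<open>auto simp: E_def\<close>)
    qed
    then have TE: "T (Suc n) = E (Suc n)"
      using card_E[OF n] cardT[OF n] finite_E by (intro card_seteq) auto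
    have "L (Suc n) \<subseteq> S (Suc n)"
    proof
      fix p assume p: "p \<in> L (Suc n)"
      show "p \<in> S (Suc n)"
      proof (cases "lv p = Suc n")
        case True
        then have "p \<in> E (Suc n)" using p by (auto simp: E_def L_def)
        then show ?thesis using TE TS by blast
      next
        case False
        then have "p \<in> S n" using p IH by (auto simp: L_def)
        then show ?thesis using S_step n by blast
      qed
    qed
    then show ?case using TE SL[OF n] by blast
  qed
  then have TE: "T k = E k" using k by blast
  obtain f where f: "\<forall>A\<in>\<P>. f A \<in> A \<inter> E k" "inj_on f \<P>" using pigeon[of "E k"] ex[OF _ k] TE by blast
  have surj: "f ` \<P> = E k"
    using f card card_E[OF k] finite_E[of k] by (intro card_seteq) (auto simp: card_image)
  show ?thesis
  proof
    show "f A \<in> A \<inter> E k" using f A by blast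
    fix p assume p: "p \<in> A \<inter> E k"
    then obtain B where B: "B \<in> \<P>" "p = f B" using surj by auto
    then have "A = B" using A p f(1) same_part by blast
    then show "p = f A" using B by simp
  qed
qed

end

section \<open>Transversal partitions are Tverberg\<close>

text \<open>A minimizer \<open>x\<close> of the sum of the squared distances to the hulls is the mean of the nearest
  points, so the displacements from \<open>x\<close> to the nearest points sum to zero.\<close>

lemma ex_common_point_or_separating:
  fixes \<P> :: "'b::euclidean_space set set"
  assumes fin: "finite \<P>" and ne: "\<P> \<noteq> {}"
    and A: "\<And>A. A \<in> \<P> \<Longrightarrow> finite A" "\<And>A. A \<in> \<P> \<Longrightarrow> A \<noteq> {}"
  obtains x c where "(\<Sum>A\<in>\<P>. c A) = 0" "\<And>A p. A \<in> \<P> \<Longrightarrow> p \<in> A \<Longrightarrow> 0 \<le> c A \<bullet> (p - x)"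
    "\<And>A. A \<in> \<P> \<Longrightarrow> c A = 0 \<Longrightarrow> x \<in> convex hull A"
proof -
  define y where "y A x = closest_point (convex hull A) x" for A :: "'b set" and x
  define g where "g x = (\<Sum>A\<in>\<P>. (norm (y A x - x))^2)" for x
  define Y where "Y = convex hull (\<Union> \<P>)"
  have cl: "closed (convex hull A)" "convex hull A \<noteq> {}" if "A \<in> \<P>" for A
    using A[OF that] by (auto intro: compact_imp_closed finite_imp_compact_convex_hull)
  have Y: "compact Y" "Y \<noteq> {}"
    using fin A ne unfolding Y_def by (auto intro!: finite_imp_compact_convex_hull)
  have "continuous_on Y g"
    unfolding g_def y_def
    by (intro continuous_intros continuous_on_closest_point cl convex_convex_hull)
  then obtain x where x: "x \<in> Y" "\<And>z. z \<in> Y \<Longrightarrow> g x \<le> g z"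
    using continuous_attains_inf[OF Y] by blast
  define c where "c A = y A x - x" for A
  define s where "s = (\<Sum>A\<in>\<P>. c A)"
  define n where "n = real (card \<P>)"
  have n: "n > 0" using fin ne by (simp add: n_def card_gt_0_iff)
  \<comment> \<open>The mean of the points nearest to \<open>x\<close>, which competes with
    \<open>x\<close> in the minimization.\<close>
  define z where "z = x + (1 / n) *\<^sub>R s"
  have yA: "y A x \<in> convex hull A" if "A \<in> \<P>" for A
    unfolding y_def using cl[OF that] by (rule closest_point_in_set)
  have "z = (\<Sum>A\<in>\<P>. (1 / n) *\<^sub>R y A x)"
    using n by (simp add: z_def s_def c_def sum_subtractf scaleR_sum_right[symmetric] algebra_simps
        n_def sum_constant_scaleR)
  also have "\<dots> \<in> Y"
    unfolding Y_def
  proof (rule convex_sum[OF fin convex_convex_hull])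
    show "(\<Sum>A\<in>\<P>. 1 / n) = 1" using n by (simp add: n_def)
    show "y A x \<in> convex hull \<Union> \<P>" if "A \<in> \<P>" for A
      using yA[OF that] hull_mono[of A "\<Union> \<P>" convex] that by blast
  qed (use n in auto)
  finally have "g x \<le> g z" by (rule x)
  also have "g z \<le> (\<Sum>A\<in>\<P>. (norm (y A x - z))^2)"
    unfolding g_def
  proof (rule sum_mono)
    fix A assume "A \<in> \<P>"
    have "dist z (y A z) \<le> dist z (y A x)"
      using closest_point_le[OF cl(1) yA] \<open>A \<in> \<P>\<close> by (simp add: y_def)
    then show "(norm (y A z - z))^2 \<le> (norm (y A x - z))^2"
      by (intro power_mono) (auto simp: dist_norm norm_minus_commute)
  qed
  also have "\<dots> = (\<Sum>A\<in>\<P>. (norm (c A))^2 - 2 / n * (c A \<bullet> s) + (s \<bullet> s) / n^2)"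
  proof (rule sum.cong)
    fix A assume "A \<in> \<P>"
    have "y A x - z = c A - (1 / n) *\<^sub>R s" by (simp add: c_def z_def)
    then show "(norm (y A x - z))^2 = (norm (c A))^2 - 2 / n * (c A \<bullet> s) + (s \<bullet> s) / n^2"
      by (simp add: power2_norm_eq_inner inner_diff inner_commute) (simp add: power2_eq_square)
  qed simp
  also have "\<dots> = g x - (\<Sum>A\<in>\<P>. 2 / n * (c A \<bullet> s)) + n * ((s \<bullet> s) / n^2)"
    by (simp add: sum.distrib sum_subtractf g_def c_def[symmetric] n_def)
  also have "(\<Sum>A\<in>\<P>. 2 / n * (c A \<bullet> s)) = 2 / n * (s \<bullet> s)"
    by (simp only: sum_distrib_left[symmetric] inner_sum_left[symmetric] s_def[symmetric])
  \<comment> \<open>Minimality has cancelled \<open>g x\<close>; the right side is only half of the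
    left, which forces \<open>s = 0\<close>.\<close>
  finally have "2 / n * (s \<bullet> s) \<le> n * ((s \<bullet> s) / n^2)" by simp
  then have "s \<bullet> s \<le> 0" using n by (simp add: power2_eq_square field_simps)
  then have "s \<bullet> s = 0" using inner_ge_zero[of s] by linarith
  then have s0: "s = 0" by simp
  show thesis
  proof (rule that[of c x])
    show "(\<Sum>A\<in>\<P>. c A) = 0" using s0 by (simp add: s_def)
    show "0 \<le> c A \<bullet> (p - x)" if "A \<in> \<P>" "p \<in> A" for A p
    proof -
      have "(x - y A x) \<bullet> (p - y A x) \<le> 0"
        unfolding y_def using that
        by (intro closest_point_dot convex_convex_hull cl) (auto intro: hull_inc)
      then have "0 \<le> c A \<bullet> (p - y A x)" by (simp add: c_def inner_diff_left)
      \<comment> \<open>Moving the base point from the nearest point back to \<open>x\<close> adds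
        the nonnegative term \<open>c A \<bullet> c A\<close>.\<close>
      also have "\<dots> \<le> c A \<bullet> (p - y A x) + c A \<bullet> c A" by simp
      also have "\<dots> = c A \<bullet> (p - x)" by (simp add: c_def inner_diff_right)
      finally show ?thesis .
    qed
    show "x \<in> convex hull A" if "A \<in> \<P>" "c A = 0" for A using yA[OF that(1)] that(2) by (simp add: c_def)
  qed
qed

section \<open>Rescaling of points and directions\<close>

context stretched_points
begin

text \<open>The recursion descends from \<open>k\<close> to the level of \<open>piv k\<close>. It is
  arranged so that \<open>piv k\<close> and all points of level \<open>k\<close> get the same
  \<open>k\<close>-th coordinate after multiplication by their weights.\<close>

function scale :: "nat \<Rightarrow> real" where
  "scale k = (if 0 < k \<and> k \<le> d
    then w (piv k) k * (scale (lv (piv k)) / w (piv k) (lv (piv k))) else 1)"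
  by auto
termination by (relation "Wellfounded.measure id") (auto simp: lv_piv)

declare scale.simps [simp del]

text \<open>The weight of \<open>p\<close> is the leading term of its coefficient in the common point sought, and
  \<open>scale k\<close> approximates the \<open>k\<close>-th coordinate of that point.\<close>

definition weight :: "'a \<Rightarrow> real" where
  "weight p = scale (lv p) / w p (lv p)"

lemma scale_0: "scale 0 = 1"
  by (simp add: scale.simps[of 0])

lemma scale_E:
  assumes "p \<in> E k" "k \<le> d"
  shows "weight p * w p k = scale k"
proof (cases "0 < k \<and> p = piv k")
  case True
  then show ?thesis using assms(2) by (simp add: scale.simps[of k] weight_def)
next
  case False
  then have "p \<in> P" "lv p = k" using assms(1) by (auto simp: E_def)
  then show ?thesis using w_pos[of p k] assms(2) by (simp add: weight_def)
qed

lemma K_power_le: "0 < i \<Longrightarrow> i < k \<Longrightarrow> k \<le> d \<Longrightarrow> K i ^ m \<le> K k"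
proof -
  assume i: "0 < i" "i < k" "k \<le> d"
  have d: "real d \<ge> 1" using d_pos by simp
  have "1 * K i ^ m \<le> (2 * (real d)^2) * K i ^ m"
  proof (rule mult_right_mono)
    have "1 \<le> (real d)^2" using d by simp
    then show "1 \<le> 2 * (real d)^2" by linarith
    show "0 \<le> K i ^ m" using K_ge_2[of i] i by simp
  qed
  also have "\<dots> \<le> K k" using K_mono[OF i] .
  finally show ?thesis by simp
qed

text \<open>Let \<open>l\<close> be the level of \<open>piv k\<close>. The claim is that
  \<open>scale l / w (piv k) l\<close> lies between 1 / \<open>K k\<close> and 1. For
  \<open>l > 0\<close> it is at most 1 because \<open>piv k\<close> lies above \<open>piv l\<close>
  in direction \<open>l\<close>. The lower bound holds because \<open>scale l\<close> is at least 1
  / \<open>K l\<close>, coordinates are at most \<open>K l ^ (m - 1)\<close>, and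
  \<open>K l ^ m \<le> K k\<close>.\<close>

lemma scale_bounds:
  assumes "0 < k" "k \<le> d"
  shows "w (piv k) k \<le> K k * scale k \<and> scale k \<le> w (piv k) k"
  using assms
proof (induction k rule: less_induct)
  case (less k)
  define p l where "p = piv k" and "l = lv p"
  have p: "p \<in> P" "l < k" "l \<le> d" using piv_in[of k] lv_piv[of k] less.prems by (auto simp: p_def l_def)
  have Kk: "K k \<ge> 2" using K_ge_2 less.prems by simp
  have sc: "scale k = w p k * (scale l / w p l)"
    using less.prems by (simp add: scale.simps[of k] p_def l_def)
  have wpk: "w p k > 0" using w_pos p less.prems by simp
  have "1 \<le> K k * (scale l / w p l) \<and> scale l / w p l \<le> 1"
  proof (cases "l = 0")
    case True
    then show ?thesis using w_0 p Kk by (simp add: scale_0)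
  next
    case False
    then have l: "0 < l" by simp
    have IH: "w (piv l) l \<le> K l * scale l" "scale l \<le> w (piv l) l"
      using less.IH[OF p(2) l p(3)] by auto
    have Kl: "K l \<ge> 2" using K_ge_2[OF l p(3)] .
    have wl: "w p l > 0" using w_pos p by simp
    have "w (piv l) l < w p l" using above_piv[OF p(1) l p(3)] by (simp add: l_def)
    then have le1: "scale l / w p l \<le> 1" using IH(2) wl by (simp add: field_simps)
    have "w p l \<le> K l ^ (m - 1) * 1" using w_le[OF p(1) l p(3)] by simp
    also have "\<dots> \<le> K l ^ (m - 1) * (K l * scale l)"
      using w_ge_1[OF piv_in[OF l p(3)] l p(3)] IH(1) Kl by (intro mult_left_mono) auto
    also have "\<dots> = K l ^ m * scale l" using m_pos by (cases m) auto
    also have "\<dots> \<le> K k * scale l"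
    proof (rule mult_right_mono)
      show "K l ^ m \<le> K k" using K_power_le l p(2) less.prems by simp
      have "0 < K l * scale l" using IH(1) w_pos[OF piv_in[OF l p(3)] p(3)] by linarith
      then show "0 \<le> scale l" using Kl by (simp add: zero_less_mult_iff)
    qed
    finally have "1 \<le> K k * (scale l / w p l)" using wl by (simp add: field_simps)
    then show ?thesis using le1 by simp
  qed
  then have *: "1 \<le> K k * (scale l / w p l)" "scale l / w p l \<le> 1" by auto
  have "w p k * 1 \<le> w p k * (K k * (scale l / w p l))" using *(1) wpk by (intro mult_left_mono) auto
  moreover have "w p k * (scale l / w p l) \<le> w p k * 1" using *(2) wpk by (intro mult_left_mono) auto
  ultimately show ?case unfolding sc p_def by (simp add: mult_ac)
qed

lemma scale_pos: "k \<le> d \<Longrightarrow> 0 < scale k"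
proof (cases "k = 0")
  case True
  then show ?thesis by (simp add: scale_0)
next
  case False
  assume k: "k \<le> d"
  have "0 < K k * scale k"
    using scale_bounds[of k] w_pos[OF piv_in[of k], of k] False k by force
  then show ?thesis using K_ge_2[of k] False k by (simp add: zero_less_mult_iff)
qed

lemma weight_pos: "p \<in> P \<Longrightarrow> 0 < weight p"
  using scale_pos[OF lv_le] w_pos[OF _ lv_le] by (simp add: weight_def)

text \<open>A point of positive level lies above the pivot of that level by the full gap, while
  \<open>scale\<close> is at most the coordinate of the pivot.\<close>

lemma weight_le:
  assumes p: "p \<in> P" and l: "0 < lv p"
  shows "K (lv p) ^ (2 * d + 3) * weight p \<le> 1"
proof -
  have "K (lv p) ^ (2 * d + 3) * scale (lv p) \<le> K (lv p) ^ (2 * d + 3) * w (piv (lv p)) (lv p)"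
    using scale_bounds[OF l lv_le[OF p]] K_ge_2[OF l lv_le[OF p]] by (intro mult_left_mono) auto
  also have "\<dots> \<le> w p (lv p)"
    using above_piv[OF p l lv_le[OF p] refl] piv_in[OF l lv_le[OF p]] p l lv_le[OF p]
    by (intro w_gap) auto
  finally show ?thesis using w_pos[OF p lv_le[OF p]] by (simp add: weight_def field_simps)
qed

lemma weight_le_1:
  assumes p: "p \<in> P"
  shows "weight p \<le> 1"
proof (cases "lv p = 0")
  case True
  then show ?thesis using w_0[OF p] by (simp add: weight_def scale_0)
next
  case False
  then have l: "0 < lv p" by simp
  have "1 * weight p \<le> K (lv p) ^ (2 * d + 3) * weight p"
    using K_ge_2[OF l lv_le[OF p]] weight_pos[OF p]
    by (intro mult_right_mono one_le_power) auto
  then show ?thesis using weight_le[OF p l] by simp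
qed

text \<open>If \<open>i\<close> is below the level \<open>l\<close> of \<open>p\<close>, the weight
  is at most \<open>K l\<close> to the power -(2d+3), and one factor \<open>K l\<close> is spent on
  \<open>w p i \<le> K l * scale i\<close>. Otherwise \<open>p\<close> lies below
  \<open>piv i\<close> by the full gap, and one factor \<open>K i\<close> is spent on comparing
  \<open>piv i\<close> with \<open>scale i\<close>. Either way a power 2d+2 of a number at least 2
  remains, which is at least 4^(d+1).\<close>

lemma weight_off_type:
  assumes p: "p \<in> P" and i: "i \<le> d" and pE: "p \<notin> E i"
  shows "weight p * w p i \<le> (1 / 4) ^ (d + 1) * scale i"
proof -
  have pow: "4 ^ (d + 1) \<le> K k ^ (2 * d + 2)" if "0 < k" "k \<le> d" for k
  proof -
    have "(4::real) ^ (d + 1) = 2 ^ (2 * d + 2)" by (simp add: power_mult)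
    also have "\<dots> \<le> K k ^ (2 * d + 2)" using K_ge_2[OF that] by (intro power_mono) auto
    finally show ?thesis .
  qed
  have "4 ^ (d + 1) * (weight p * w p i) \<le> scale i"
  proof (cases "i < lv p")
    case True
    define l where "l = lv p"
    have l: "0 < l" "l \<le> d" "i < l" using True lv_le[OF p] by (auto simp: l_def)
    have Kl: "K l \<ge> 2" using K_ge_2 l by simp
    have wi: "w p i \<le> K l * scale i"
    proof (cases "i = 0")
      case True
      then show ?thesis using w_0[OF p] Kl by (simp add: scale_0)
    next
      case False
      then have i0: "0 < i" by simp
      have "w p i \<le> K i ^ (m - 1) * 1" using w_le[OF p i0 i] by simp
      also have "\<dots> \<le> K i ^ (m - 1) * (K i * scale i)"
        using w_ge_1[OF piv_in[OF i0 i] i0 i] scale_bounds[OF i0 i] K_ge_2[OF i0 i]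
        by (intro mult_left_mono) auto
      also have "\<dots> = K i ^ m * scale i" using m_pos by (cases m) auto
      also have "\<dots> \<le> K l * scale i"
        using K_power_le[OF i0 l(3) l(2)] scale_pos[OF i] by (intro mult_right_mono) auto
      finally show ?thesis .
    qed
    have "4 ^ (d + 1) * (weight p * w p i) \<le> K l ^ (2 * d + 2) * (weight p * (K l * scale i))"
      using pow[OF l(1,2)] wi weight_pos[OF p] w_pos[OF p i] Kl
      by (intro mult_mono mult_left_mono) auto
    also have "\<dots> = (K l ^ (2 * d + 3) * weight p) * scale i"
      by (simp add: power_add eval_nat_numeral)
    also have "\<dots> \<le> 1 * scale i"
      using weight_le[OF p] l scale_pos[OF i] by (intro mult_right_mono) (auto simp: l_def)
    finally show ?thesis by simp
  next
    case False
    then have l: "lv p < i" "p \<noteq> piv i" using p pE by (auto simp: E_def)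
    then have i0: "0 < i" by simp
    have Ki: "K i \<ge> 2" using K_ge_2 i i0 by simp
    have "w p i < w (piv i) i"
      using below_piv[OF p i0 i l(1)] w_inj[OF p piv_in[OF i0 i] i0 i] l(2) by force
    then have "K i ^ (2 * d + 3) * w p i \<le> w (piv i) i"
      using w_gap p piv_in i0 i by simp
    also have "\<dots> \<le> K i * scale i" using scale_bounds[OF i0 i] by simp
    finally have "K i * (K i ^ (2 * d + 2) * w p i) \<le> K i * scale i"
      by (simp add: power_add eval_nat_numeral mult_ac)
    then have *: "K i ^ (2 * d + 2) * w p i \<le> scale i" using Ki by simp
    have "4 ^ (d + 1) * (weight p * w p i) \<le> K i ^ (2 * d + 2) * (1 * w p i)"
      using pow[OF i0 i] weight_le_1[OF p] weight_pos[OF p] w_pos[OF p i] Ki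
      by (intro mult_mono) auto
    then show ?thesis using * by simp
  qed
  then show ?thesis by (simp add: power_divide field_simps)
qed

section \<open>Vanishing of separating families\<close>

text \<open>The \<open>c A\<close> are affine functions, nonnegative on \<open>A\<close>, with sum
  zero. After rescaling, the value at \<open>p\<close> is nearly \<open>v A p\<close>, the sum of
  the coefficients over the types of \<open>p\<close>. So the \<open>v A p\<close> are almost
  nonnegative with total zero, hence small. Solving for the coefficients from direction
  \<open>d\<close> downwards bounds their total \<open>M\<close> by 3/4 of itself.\<close>

lemma separating_family_zero:
  assumes part: "partition_on P \<P>"
    and tr: "\<And>A k. A \<in> \<P> \<Longrightarrow> k \<le> d \<Longrightarrow> \<exists>!p. p \<in> A \<inter> E k"
    and c0: "\<And>i. i \<le> d \<Longrightarrow> (\<Sum>A\<in>\<P>. c A i) = 0"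
    and c_nonneg: "\<And>A p. A \<in> \<P> \<Longrightarrow> p \<in> A \<Longrightarrow> 0 \<le> (\<Sum>i\<le>d. c A i * w p i)"
    and A0: "A0 \<in> \<P>" and i0: "i0 \<le> d"
  shows "c A0 i0 = 0"
proof -
  have fin\<P>: "finite \<P>" using part fin finite_elements by blast
  have AP: "A \<subseteq> P" if "A \<in> \<P>" for A using that partition_onD1[OF part] by auto
  have finA: "finite A" if "A \<in> \<P>" for A using AP[OF that] fin finite_subset by blast
  define u where "u A i = c A i * scale i" for A i
  define e where "e = (1 / 4 :: real) ^ (d + 1)"
  have e: "e > 0" by (simp add: e_def)
  define ty where "ty p = {i. i \<le> d \<and> p \<in> E i}" for p
  have ty: "ty p \<subseteq> {..d}" "finite (ty p)" for p by (auto simp: ty_def)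
  define v where "v A p = (\<Sum>i\<in>ty p. u A i)" for A p
  define MA where "MA A = (\<Sum>i\<le>d. \<bar>u A i\<bar>)" for A
  define M where "M = (\<Sum>A\<in>\<P>. MA A)"
  \<comment> \<open>Multiply the inequality at \<open>p\<close> by \<open>weight p\<close>:
    directions in \<open>ty p\<close> contribute exactly \<open>v A p\<close>, the others at most
    \<open>e * MA A\<close>.\<close>
  have v_ge: "- e * MA A \<le> v A p" if A: "A \<in> \<P>" and p: "p \<in> A" for A p
  proof -
    have pP: "p \<in> P" using AP A p by blast
    have "0 \<le> weight p * (\<Sum>i\<le>d. c A i * w p i)"
      using c_nonneg[OF A p] weight_pos[OF pP] by simp
    also have "\<dots> = (\<Sum>i\<le>d. c A i * (weight p * w p i))" by (simp add: sum_distrib_left mult_ac)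
    also have "\<dots> = (\<Sum>i\<in>{..d} - ty p. c A i * (weight p * w p i)) +
        (\<Sum>i\<in>ty p. c A i * (weight p * w p i))"
      using ty(1) by (intro sum.subset_diff) auto
    also have "(\<Sum>i\<in>ty p. c A i * (weight p * w p i)) = v A p"
      unfolding v_def u_def by (intro sum.cong refl) (auto simp: ty_def scale_E)
    also have "(\<Sum>i\<in>{..d} - ty p. c A i * (weight p * w p i)) \<le> (\<Sum>i\<in>{..d} - ty p. e * \<bar>u A i\<bar>)"
    proof (rule sum_mono)
      fix i assume i: "i \<in> {..d} - ty p"
      then have "i \<le> d" "p \<notin> E i" by (auto simp: ty_def)
      then have "0 \<le> weight p * w p i" "weight p * w p i \<le> e * scale i"
        using weight_off_type[OF pP] weight_pos[OF pP] w_pos[OF pP, of i] by (auto simp: e_def)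
      then have "c A i * (weight p * w p i) \<le> \<bar>c A i\<bar> * (e * scale i)"
        by (intro mult_mono[OF abs_ge_self]) auto
      also have "\<dots> = e * \<bar>u A i\<bar>" using scale_pos[OF \<open>i \<le> d\<close>] by (simp add: u_def abs_mult)
      finally show "c A i * (weight p * w p i) \<le> e * \<bar>u A i\<bar>" .
    qed
    also have "(\<Sum>i\<in>{..d} - ty p. e * \<bar>u A i\<bar>) \<le> (\<Sum>i\<le>d. e * \<bar>u A i\<bar>)"
      using e by (intro sum_mono2) auto
    also have "\<dots> = e * MA A" by (simp add: MA_def sum_distrib_left)
    finally show ?thesis by simp
  qed
  have u0: "(\<Sum>A\<in>\<P>. u A i) = 0" if "i \<le> d" for i
    using c0[OF that] by (simp add: u_def sum_distrib_right[symmetric])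
  define V where "V k = (\<Sum>A\<in>\<P>. \<Sum>p\<in>{p \<in> A. lv p = k}. \<bar>v A p\<bar>)" for k
  \<comment> \<open>Every \<open>p\<close> lies in \<open>E (lv p)\<close>, and \<open>A\<close> has
    one point in each of the \<open>d + 1\<close> sets.\<close>
  have cardA: "card A \<le> d + 1" if A: "A \<in> \<P>" for A
  proof -
    have "A \<subseteq> (\<Union>k\<in>{..d}. A \<inter> E k)" using AP[OF A] lv_le by (auto simp: E_def)
    then have "card A \<le> card (\<Union>k\<in>{..d}. A \<inter> E k)" using finA[OF A] by (intro card_mono) auto
    also have "\<dots> \<le> (\<Sum>k\<in>{..d}. card (A \<inter> E k))" by (rule card_UN_le) simp
    also have "\<dots> = (\<Sum>k\<in>{..d}. 1)"
    proof (rule sum.cong)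
      fix k assume "k \<in> {..d}"
      then obtain q where "A \<inter> E k = {q}" using tr[OF A, of k] by auto
      then show "card (A \<inter> E k) = 1" by simp
    qed simp
    finally show ?thesis by simp
  qed
  \<comment> \<open>Each \<open>i \<le> d\<close> is a type of exactly one point of
    \<open>A\<close>.\<close>
  have sum_v: "(\<Sum>p\<in>A. v A p) = (\<Sum>i\<le>d. u A i)" if A: "A \<in> \<P>" for A
  proof -
    have "(\<Sum>p\<in>A. v A p) = (\<Sum>p\<in>A. \<Sum>i\<le>d. if p \<in> E i then u A i else 0)"
      using sum.inter_filter[of "{..d}" "u A"] by (simp add: v_def ty_def)
    also have "\<dots> = (\<Sum>i\<le>d. \<Sum>p\<in>A. if p \<in> E i then u A i else 0)" by (rule sum.swap)
    also have "\<dots> = (\<Sum>i\<le>d. u A i)"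
    proof (rule sum.cong)
      fix i assume "i \<in> {..d}"
      then obtain q where "A \<inter> E i = {q}" using tr[OF A, of i] by auto
      then show "(\<Sum>p\<in>A. if p \<in> E i then u A i else 0) = u A i"
        using finA[OF A] by (simp add: sum.If_cases)
    qed simp
    finally show ?thesis .
  qed
  have "(\<Sum>k\<le>d. V k) = (\<Sum>A\<in>\<P>. \<Sum>k\<le>d. \<Sum>p\<in>{p \<in> A. lv p = k}. \<bar>v A p\<bar>)"
    unfolding V_def by (rule sum.swap)
  also have "\<dots> = (\<Sum>A\<in>\<P>. \<Sum>p\<in>A. \<bar>v A p\<bar>)"
  proof (rule sum.cong)
    fix A assume A: "A \<in> \<P>"
    show "(\<Sum>k\<le>d. \<Sum>p\<in>{p \<in> A. lv p = k}. \<bar>v A p\<bar>) = (\<Sum>p\<in>A. \<bar>v A p\<bar>)"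
      using AP[OF A] lv_le finA[OF A] by (intro sum.group) auto
  qed simp
  \<comment> \<open>A number that is at least -t, with t nonnegative, has absolute value at most
    itself plus 2t. The \<open>v A p\<close> add up to zero, so only the error terms
    survive.\<close>
  also have "\<dots> \<le> (\<Sum>A\<in>\<P>. \<Sum>p\<in>A. v A p + 2 * e * MA A)"
    using v_ge e by (intro sum_mono) (force simp: MA_def abs_le_iff intro!: mult_nonneg_nonneg sum_nonneg)
  also have "\<dots> = (\<Sum>A\<in>\<P>. \<Sum>i\<le>d. u A i) + (\<Sum>A\<in>\<P>. card A * (2 * e * MA A))"
    by (simp add: sum.distrib sum_v)
  also have "(\<Sum>A\<in>\<P>. \<Sum>i\<le>d. u A i) = (\<Sum>i\<le>d. \<Sum>A\<in>\<P>. u A i)" by (rule sum.swap)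
  also have "\<dots> = 0" using u0 by simp
  also have "(\<Sum>A\<in>\<P>. card A * (2 * e * MA A)) \<le> (\<Sum>A\<in>\<P>. real (d + 1) * (2 * e * MA A))"
  proof (rule sum_mono)
    fix A assume "A \<in> \<P>"
    then have "real (card A) \<le> real (d + 1)" using cardA by (simp only: of_nat_le_iff)
    moreover have "0 \<le> 2 * e * MA A" using e by (simp add: MA_def sum_nonneg)
    ultimately show "card A * (2 * e * MA A) \<le> real (d + 1) * (2 * e * MA A)"
      by (rule mult_right_mono)
  qed
  also have "\<dots> = 2 * e * (d + 1) * M"
    unfolding M_def sum_distrib_left by (intro sum.cong refl) (simp add: mult_ac)
  finally have V_le: "(\<Sum>k\<le>d. V k) \<le> 2 * e * (d + 1) * M" by simp
  have V0: "V k \<ge> 0" for k by (simp add: V_def sum_nonneg)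
  \<comment> \<open>The part containing \<open>piv k\<close>, as a set; it is empty for
    \<open>k = 0\<close>. \<open>W k\<close> collects the other parts, and by \<open>N_le\<close>
    the zero sum lets them control the excluded coefficient.\<close>
  define G where "G k = {A \<in> \<P>. 0 < k \<and> piv k \<in> A}" for k
  have G: "G k \<subseteq> \<P>" "finite (G k)" for k using fin\<P> by (auto simp: G_def)
  define W where "W k = (\<Sum>A\<in>\<P> - G k. \<bar>u A k\<bar>)" for k
  have W0: "W k \<ge> 0" for k by (simp add: W_def sum_nonneg)
  have N_le: "(\<Sum>A\<in>G k. \<bar>u A k\<bar>) \<le> W k" if k: "k \<le> d" for k
  proof (cases "k = 0")
    case True
    then show ?thesis using W0 by (simp add: G_def)
  next
    case False
    then have "piv k \<in> P" using piv_in k by simp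
    then obtain B where B: "B \<in> \<P>" "piv k \<in> B" using partition_onD1[OF part] by blast
    have GB: "G k = {B}"
      using B False partition_onD2[OF part] by (auto simp: G_def disjoint_def)
    have "(\<Sum>A\<in>\<P>. u A k) = u B k + (\<Sum>A\<in>\<P> - {B}. u A k)" using fin\<P> B by (simp add: sum.remove)
    then have "u B k = - (\<Sum>A\<in>\<P> - {B}. u A k)" using u0[OF k] by simp
    then have "\<bar>u B k\<bar> = \<bar>\<Sum>A\<in>\<P> - {B}. u A k\<bar>" by simp
    also have "\<dots> \<le> W k" unfolding W_def GB by (rule sum_abs)
    finally show ?thesis by (simp add: GB)
  qed
  text \<open>A part without \<open>piv k\<close> meets \<open>E k\<close> in a point of level \<open>k\<close>, whose other types \<open>i\<close> satisfy
    \<open>i > k\<close> and are witnessed by \<open>piv i\<close>.\<close>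
  have W_le: "W k \<le> V k + (\<Sum>i\<in>{k<..d}. W i)" if k: "k \<le> d" for k
  proof -
    have "W k \<le> (\<Sum>A\<in>\<P> - G k. (\<Sum>p\<in>{p \<in> A. lv p = k}. \<bar>v A p\<bar>) +
        (\<Sum>i\<in>{k<..d}. if A \<in> G i then \<bar>u A i\<bar> else 0))"
      unfolding W_def
    proof (rule sum_mono)
      fix A assume A: "A \<in> \<P> - G k"
      then obtain p where p: "p \<in> A" "p \<in> E k" using tr[of A k] k by blast
      have lv: "lv p = k" using p A by (auto simp: E_def G_def)
      have others: "k < i \<and> A \<in> G i" if "i \<in> ty p - {k}" for i
      proof -
        have "0 < i" "p = piv i" "i \<le> d" using that lv by (auto simp: ty_def E_def)
        then show ?thesis using lv_piv[of i] lv p A by (auto simp: G_def)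
      qed
      have sub: "ty p - {k} \<subseteq> {k<..d}"
      proof
        fix i assume "i \<in> ty p - {k}"
        then show "i \<in> {k<..d}" using others[of i] ty(1)[of p] by auto
      qed
      have "v A p = u A k + (\<Sum>i\<in>ty p - {k}. u A i)"
        unfolding v_def using p k ty(2) by (intro sum.remove) (auto simp: ty_def)
      then have "\<bar>u A k\<bar> \<le> \<bar>v A p\<bar> + \<bar>\<Sum>i\<in>ty p - {k}. u A i\<bar>" by linarith
      also have "\<bar>v A p\<bar> \<le> (\<Sum>p\<in>{p \<in> A. lv p = k}. \<bar>v A p\<bar>)"
        using p lv finA A by (intro member_le_sum) auto
      also have "\<bar>\<Sum>i\<in>ty p - {k}. u A i\<bar> \<le> (\<Sum>i\<in>ty p - {k}. \<bar>u A i\<bar>)" by (rule sum_abs)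
      also have "\<dots> = (\<Sum>i\<in>ty p - {k}. if A \<in> G i then \<bar>u A i\<bar> else 0)"
        using others by (intro sum.cong) auto
      also have "\<dots> \<le> (\<Sum>i\<in>{k<..d}. if A \<in> G i then \<bar>u A i\<bar> else 0)"
        using sub by (intro sum_mono2) auto
      finally show "\<bar>u A k\<bar> \<le> (\<Sum>p\<in>{p \<in> A. lv p = k}. \<bar>v A p\<bar>) +
          (\<Sum>i\<in>{k<..d}. if A \<in> G i then \<bar>u A i\<bar> else 0)" by simp
    qed
    also have "\<dots> \<le> (\<Sum>A\<in>\<P>. (\<Sum>p\<in>{p \<in> A. lv p = k}. \<bar>v A p\<bar>) +
        (\<Sum>i\<in>{k<..d}. if A \<in> G i then \<bar>u A i\<bar> else 0))"
      using fin\<P> by (intro sum_mono2) (auto intro!: add_nonneg_nonneg sum_nonneg)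
    also have "\<dots> = V k + (\<Sum>i\<in>{k<..d}. \<Sum>A\<in>\<P>. if A \<in> G i then \<bar>u A i\<bar> else 0)"
      by (simp add: sum.distrib V_def sum.swap[of _ "{k<..d}" \<P>])
    also have "(\<Sum>i\<in>{k<..d}. \<Sum>A\<in>\<P>. if A \<in> G i then \<bar>u A i\<bar> else 0) \<le> (\<Sum>i\<in>{k<..d}. W i)"
    proof (rule sum_mono)
      fix i assume "i \<in> {k<..d}"
      then have "(\<Sum>A\<in>G i. \<bar>u A i\<bar>) \<le> W i" using N_le by simp
      moreover have "\<P> \<inter> G i = G i" using G by blast
      ultimately show "(\<Sum>A\<in>\<P>. if A \<in> G i then \<bar>u A i\<bar> else 0) \<le> W i"
        using fin\<P> by (simp add: sum.If_cases)
    qed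
    finally show ?thesis by simp
  qed
  \<comment> \<open>Descending induction: by \<open>W_le\<close>, adding a direction at most doubles
    the tail and adds one \<open>V\<close>.\<close>
  have Z_le: "(\<Sum>i\<in>{k..d}. W i) \<le> 2 ^ (d - k) * (\<Sum>i\<in>{k..d}. V i)" if "k \<le> d" for k
    using that
  proof (induction k rule: inc_induct)
    case base
    show ?case using W_le[of d] by simp
  next
    case (step n)
    have split: "{n..d} = insert n {Suc n..d}" "{n<..d} = {Suc n..d}" using step by auto
    have dn: "d - n = Suc (d - Suc n)" using step by simp
    have "(\<Sum>i\<in>{n..d}. W i) = W n + (\<Sum>i\<in>{Suc n..d}. W i)" by (simp add: split)
    also have "\<dots> \<le> V n + 2 * (\<Sum>i\<in>{Suc n..d}. W i)" using W_le[of n] step by (simp add: split)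
    also have "\<dots> \<le> V n + 2 * (2 ^ (d - Suc n) * (\<Sum>i\<in>{Suc n..d}. V i))" using step by simp
    also have "\<dots> \<le> 2 ^ (d - n) * V n + 2 ^ (d - n) * (\<Sum>i\<in>{Suc n..d}. V i)"
      using mult_right_mono[OF one_le_power[of "2 :: real" "d - n"] V0[of n]] by (simp add: dn)
    also have "\<dots> = 2 ^ (d - n) * (\<Sum>i\<in>{n..d}. V i)" by (simp add: split distrib_left)
    finally show ?case .
  qed
  have "M = (\<Sum>i\<le>d. \<Sum>A\<in>\<P>. \<bar>u A i\<bar>)" unfolding M_def MA_def by (rule sum.swap)
  also have "\<dots> = (\<Sum>i\<le>d. W i + (\<Sum>A\<in>G i. \<bar>u A i\<bar>))"
    unfolding W_def using fin\<P> G(1) by (intro sum.cong sum.subset_diff refl) auto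
  also have "\<dots> = (\<Sum>i\<in>{0..d}. W i) + (\<Sum>i\<in>{0..d}. \<Sum>A\<in>G i. \<bar>u A i\<bar>)"
    by (simp add: sum.distrib atLeast0AtMost)
  \<comment> \<open>\<open>G 0\<close> is empty, so this sum starts at 1 and costs only
    \<open>2 ^ (d - 1)\<close> instead of \<open>2 ^ d\<close>.\<close>
  also have "(\<Sum>i\<in>{0..d}. \<Sum>A\<in>G i. \<bar>u A i\<bar>) = (\<Sum>i\<in>{1..d}. \<Sum>A\<in>G i. \<bar>u A i\<bar>)"
    by (intro sum.mono_neutral_right) (auto simp: G_def not_le)
  also have "\<dots> \<le> (\<Sum>i\<in>{1..d}. W i)" using N_le by (intro sum_mono) auto
  also have "\<dots> \<le> 2 ^ (d - 1) * (\<Sum>i\<in>{1..d}. V i)" using Z_le[of 1] d_pos by simp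
  also have "\<dots> \<le> 2 ^ (d - 1) * (\<Sum>i\<le>d. V i)" using V0 by (intro mult_left_mono sum_mono2) auto
  also have "(\<Sum>i\<in>{0..d}. W i) \<le> 2 ^ d * (\<Sum>i\<le>d. V i)" using Z_le[of 0] by (simp add: atLeast0AtMost)
  finally have "M \<le> 2 ^ d * (\<Sum>i\<le>d. V i) + 2 ^ (d - 1) * (\<Sum>i\<le>d. V i)" by simp
  also have "\<dots> = 3 * 2 ^ (d - 1) * (\<Sum>i\<le>d. V i)" using d_pos by (cases d) auto
  also have "\<dots> \<le> 3 * 2 ^ (d - 1) * (2 * e * (d + 1) * M)" using V_le by (intro mult_left_mono) auto
  also have "\<dots> = 3 * (2 * 2 ^ (d - 1)) * ((d + 1) * (e * M))" by (simp add: mult_ac)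
  also have "\<dots> = 3 * 2 ^ d * ((d + 1) * (e * M))" using d_pos by (cases d) auto
  also have "\<dots> \<le> 3 * 2 ^ d * (2 ^ d * (e * M))"
  proof (intro mult_left_mono mult_right_mono)
    have "d + 1 \<le> 2 ^ d" by (induction d) auto
    then show "real (d + 1) \<le> 2 ^ d" by (metis of_nat_le_iff of_nat_numeral of_nat_power)
    show "0 \<le> e * M" using e by (simp add: M_def MA_def sum_nonneg)
  qed auto
  \<comment> \<open>The accumulated factor is \<open>3 * 4 ^ d * e\<close>; the exponent
    \<open>d + 1\<close> in \<open>e\<close> makes it 3/4.\<close>
  also have "\<dots> = 3 / 4 * M" by (simp add: e_def power_divide power_mult_distrib[symmetric])
  finally have "M \<le> 0" by simp
  moreover have MA0: "MA A \<ge> 0" for A by (simp add: MA_def sum_nonneg)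
  moreover have "\<bar>u A0 i0\<bar> \<le> MA A0" unfolding MA_def using i0 by (intro member_le_sum) auto
  moreover have "MA A0 \<le> M" unfolding M_def using A0 fin\<P> MA0 by (intro member_le_sum) auto
  ultimately have "u A0 i0 = 0" by linarith
  then show ?thesis using scale_pos[OF i0] by (simp add: u_def)
qed

end

section \<open>From the stretched grid to levels\<close>

lemma ex_max_point:
  fixes f :: "'a \<Rightarrow> real"
  assumes "finite S" "S \<noteq> {}"
  shows "\<exists>q\<in>S. \<forall>p\<in>S. f p \<le> f q"
proof -
  have "Max (f ` S) \<in> f ` S" using assms by (intro Max_in) auto
  then obtain q where "q \<in> S" "f q = Max (f ` S)" by auto
  then show ?thesis using assms by (intro bexI[of _ q]) auto
qed

text \<open>Induction on \<open>n\<close>: the threshold point \<open>q\<close> moves into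
  \<open>D\<close>, and the highest remaining point replaces it.\<close>

lemma ex_top_points:
  fixes f :: "'a \<Rightarrow> real"
  assumes "finite S" "inj_on f S" "n < card S"
  shows "\<exists>D q. D \<subseteq> S \<and> card D = n \<and> q \<in> S - D \<and> (\<forall>p\<in>D. f q < f p) \<and> (\<forall>p\<in>S - D. f p \<le> f q)"
  using assms(3)
proof (induction n)
  case 0
  then have "S \<noteq> {}" by auto
  then obtain q where "q \<in> S" "\<forall>p\<in>S. f p \<le> f q" using ex_max_point[OF assms(1)] by blast
  then show ?case by (intro exI[of _ "{}"] exI[of _ q]) auto
next
  case (Suc n)
  then obtain D q where D: "D \<subseteq> S" "card D = n" "q \<in> S - D" "\<forall>p\<in>D. f q < f p"
    "\<forall>p\<in>S - D. f p \<le> f q" by auto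
  define D' where "D' = insert q D"
  have finD: "finite D" using D(1) assms(1) finite_subset by blast
  have D': "D' \<subseteq> S" "card D' = Suc n" using D finD by (auto simp: D'_def)
  have "S - D' \<noteq> {}"
  proof
    assume "S - D' = {}"
    then have "S = D'" using D'(1) by blast
    then show False using D'(2) Suc.prems by simp
  qed
  then obtain q' where q': "q' \<in> S - D'" "\<forall>p\<in>S - D'. f p \<le> f q'"
    using ex_max_point[of "S - D'" f] assms(1) by auto
  have "f q' < f q"
  proof -
    have "q' \<in> S - D" "q' \<noteq> q" using q' by (auto simp: D'_def)
    then have "f q' \<le> f q" "f q' \<noteq> f q" using D assms(2) by (auto simp: inj_on_def)
    then show ?thesis by simp
  qed
  then have "\<forall>p\<in>D'. f q' < f p" using D(4) by (auto simp: D'_def)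
  then show ?case using D' q' by (intro exI[of _ D'] exI[of _ q']) auto
qed

text \<open>The \<open>r - 1\<close> highest points in the last direction form the last level and
  are removed; the next one becomes the pivot but stays. The count drops by \<open>r - 1\<close>, so
  induction on \<open>d\<close> applies, ending with \<open>r\<close> points at level 0.\<close>

lemma ex_greedy_levels:
  fixes w :: "'a \<Rightarrow> nat \<Rightarrow> real"
  assumes "finite P" "card P = (r - 1) * (d + 1) + 1" "r \<ge> 1"
    and "\<And>k. 0 < k \<Longrightarrow> k \<le> d \<Longrightarrow> inj_on (\<lambda>p. w p k) P"
  shows "\<exists>lv piv. greedy_levels d r P lv piv \<and>
    (\<forall>p\<in>P. \<forall>k. 0 < k \<longrightarrow> k \<le> d \<longrightarrow> lv p = k \<longrightarrow> w (piv k) k < w p k) \<and>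
    (\<forall>p\<in>P. \<forall>k. 0 < k \<longrightarrow> k \<le> d \<longrightarrow> lv p < k \<longrightarrow> w p k \<le> w (piv k) k)"
  using assms
proof (induction d arbitrary: P)
  case 0
  have "greedy_levels 0 r P (\<lambda>_. 0) piv" for piv
    using 0 by unfold_locales auto
  then show ?case by auto
next
  case (Suc d)
  let ?k = "Suc d"
  obtain D q where D: "D \<subseteq> P" "card D = r - 1" "q \<in> P - D" "\<forall>p\<in>D. w q ?k < w p ?k"
    "\<forall>p\<in>P - D. w p ?k \<le> w q ?k"
    using ex_top_points[OF Suc.prems(1) Suc.prems(4)[of ?k], of "r - 1"] Suc.prems(2) by auto
  have finD: "finite D" using D(1) Suc.prems(1) finite_subset by blast
  have cardPD: "card (P - D) = (r - 1) * (d + 1) + 1"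
    using D(1,2) finD Suc.prems(2) by (simp add: card_Diff_subset)
  have "inj_on (\<lambda>p. w p k) (P - D)" if "0 < k" "k \<le> d" for k
    using Suc.prems(4)[of k] that inj_on_subset[of _ P "P - D"] by auto
  then have "\<exists>lv piv. greedy_levels d r (P - D) lv piv \<and>
    (\<forall>p\<in>P - D. \<forall>k. 0 < k \<longrightarrow> k \<le> d \<longrightarrow> lv p = k \<longrightarrow> w (piv k) k < w p k) \<and>
    (\<forall>p\<in>P - D. \<forall>k. 0 < k \<longrightarrow> k \<le> d \<longrightarrow> lv p < k \<longrightarrow> w p k \<le> w (piv k) k)"
    using Suc.prems(1) by (intro Suc.IH[OF _ cardPD Suc.prems(3)]) auto
  then obtain lv piv where gl: "greedy_levels d r (P - D) lv piv"
    and above: "\<forall>p\<in>P - D. \<forall>k. 0 < k \<longrightarrow> k \<le> d \<longrightarrow> lv p = k \<longrightarrow> w (piv k) k < w p k"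
    and below: "\<forall>p\<in>P - D. \<forall>k. 0 < k \<longrightarrow> k \<le> d \<longrightarrow> lv p < k \<longrightarrow> w p k \<le> w (piv k) k"
    by (elim exE conjE)
  interpret gl: greedy_levels d r "P - D" lv piv by (rule gl)
  define lv' where "lv' p = (if p \<in> D then ?k else lv p)" for p
  define piv' where "piv' = piv(?k := q)"
  have lv'_D: "lv' p = ?k \<longleftrightarrow> p \<in> D" if "p \<in> P" for p
    using gl.lv_le[of p] that by (auto simp: lv'_def)
  have level: "{p \<in> P. lv' p = k} = {p \<in> P - D. lv p = k}" if "k \<le> d" for k
    using that by (auto simp: lv'_def)
  have piv_D: "piv' k \<in> P - D" "lv (piv' k) < k" if "0 < k" "k \<le> ?k" for k
  proof -
    show "piv' k \<in> P - D" using gl.piv_in[of k] D(3) that by (auto simp: piv'_def)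
    show "lv (piv' k) < k"
      using gl.lv_piv[of k] gl.lv_le[of q] D(3) that by (cases "k = ?k") (auto simp: piv'_def)
  qed
  have "greedy_levels ?k r P lv' piv'"
  proof
    show "1 \<le> r" "finite P" by (fact Suc.prems)+
    show "lv' p \<le> ?k" if "p \<in> P" for p using gl.lv_le[of p] that by (auto simp: lv'_def)
    show "card {p \<in> P. lv' p = 0} = r" using level[of 0] gl.card_level0 by simp
    show "card {p \<in> P. lv' p = k} = r - 1" if "0 < k" "k \<le> ?k" for k
    proof (cases "k = ?k")
      case True
      have "{p \<in> P. lv' p = ?k} = D" using lv'_D D(1) by auto
      then show ?thesis using True D(2) by simp
    qed (use that level[of k] gl.card_level[of k] in auto)
    show "piv' k \<in> P" "lv' (piv' k) < k" if "0 < k" "k \<le> ?k" for k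
      using piv_D[OF that] by (auto simp: lv'_def)
  qed
  moreover have "w (piv' k) k < w p k" if p: "p \<in> P" "0 < k" "k \<le> ?k" "lv' p = k" for p k
  proof (cases "k = ?k")
    case True
    then show ?thesis using p lv'_D D(4) by (simp add: piv'_def)
  next
    case False
    then show ?thesis using p lv'_D[of p] above by (auto simp: piv'_def lv'_def)
  qed
  moreover have "w p k \<le> w (piv' k) k" if p: "p \<in> P" "0 < k" "k \<le> ?k" "lv' p < k" for p k
  proof (cases "k = ?k")
    case True
    then show ?thesis using p lv'_D[of p] D(5) by (simp add: piv'_def)
  next
    case False
    then show ?thesis using p below by (auto simp: piv'_def lv'_def split: if_splits)
  qed
  ultimately show ?case by blast
qed

section \<open>Coordinates in rank order and gaps between points\<close>

text \<open>Inverting the rank \<open>card {..i}\<close> turns the predecessor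
  \<open>Max {..<i}\<close> of the stretching condition into the index \<open>k - 1\<close>.\<close>

lemma ex_rank_enumeration:
  obtains e :: "nat \<Rightarrow> 'd::{finite,linorder}"
  where "bij_betw e {1..CARD('d)} UNIV" "e 1 = Min UNIV"
    "\<And>k. 1 < k \<Longrightarrow> k \<le> CARD('d) \<Longrightarrow> e k \<noteq> Min UNIV \<and> Max {..<e k} = e (k - 1)"
proof -
  define rk where "rk i = card {..i}" for i :: 'd
  have mono: "rk i < rk j" if "i < j" for i j
    unfolding rk_def using that by (intro psubset_card_mono) auto
  have inj: "inj rk"
  proof
    fix i j assume "rk i = rk j"
    then show "i = j" using mono[of i j] mono[of j i] by (cases i j rule: linorder_cases) auto
  qed
  have "range rk \<subseteq> {1..CARD('d)}"
    unfolding rk_def by (auto simp: Suc_le_eq card_gt_0_iff card_mono)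
  then have "range rk = {1..CARD('d)}" using inj by (intro card_subset_eq) (auto simp: card_image)
  then have bij: "bij_betw rk UNIV {1..CARD('d)}" using inj by (simp add: bij_betw_def)
  define e where "e = inv_into UNIV rk"
  have e_rk: "e (rk i) = i" for i using inj by (simp add: e_def)
  have rk_e: "rk (e k) = k" if "k \<in> {1..CARD('d)}" for k
    using bij_betw_inv_into_right[OF bij that] by (simp add: e_def)
  have rk_Min: "rk (Min UNIV) = 1"
  proof -
    have "{..Min (UNIV :: 'd set)} = {Min UNIV}" by (auto intro: antisym)
    then show ?thesis by (simp add: rk_def)
  qed
  show thesis
  proof (rule that[of e])
    show "bij_betw e {1..CARD('d)} UNIV" unfolding e_def using bij by (rule bij_betw_inv_into)
    show "e 1 = Min UNIV" using e_rk[of "Min UNIV"] rk_Min by simp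
    fix k assume k: "1 < k" "k \<le> CARD('d)"
    then have rk: "rk (e k) = k" using rk_e by simp
    have ne: "e k \<noteq> Min UNIV" using rk k rk_Min by auto
    then have "Min UNIV < e k" by (simp add: order_less_le)
    then have "{..<e k} \<noteq> {}" by auto
    then have "Max {..<e k} \<in> {..<e k}" by (intro Max_in) auto
    then have "{..Max {..<e k}} = {..<e k}" by (auto intro: le_less_trans)
    then have "rk (Max {..<e k}) = card {..<e k}" by (simp add: rk_def)
    moreover have "{..e k} = insert (e k) {..<e k}" by auto
    then have "rk (e k) = Suc (card {..<e k})" by (simp add: rk_def)
    ultimately have "rk (Max {..<e k}) = k - 1" using rk by simp
    then show "e k \<noteq> Min UNIV \<and> Max {..<e k} = e (k - 1)" using e_rk ne by metis
  qed
qed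

text \<open>In logarithms to base \<open>K i\<close> the stretched distance is an absolute
  difference, so distance at least \<open>n\<close> becomes the factor
  \<open>K i ^ n\<close>.\<close>

lemma far_apart_gap:
  assumes "stretching_constants m K" "p \<in> bounding_box m K" "q \<in> bounding_box m K"
    and far: "far_apart K (real n) p q"
  shows "p $ i < q $ i \<Longrightarrow> K i ^ n * p $ i \<le> q $ i"
    and "0 < n \<Longrightarrow> p $ i \<noteq> q $ i"
proof -
  have K: "K i > 1" using stretching_constants_ge_2[OF assms(1), of i] by simp
  have pq: "p $ i > 0" "q $ i > 0"
    using assms(2,3) by (auto simp: bounding_box_def mem_box_cart intro: less_le_trans[of 0 1])
  have n: "real n \<le> \<bar>log (K i) (p $ i) - log (K i) (q $ i)\<bar>"
    using far unfolding far_apart_def stretched_dist_bounding_box[OF assms(1-3)] by blast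
  then show "0 < n \<Longrightarrow> p $ i \<noteq> q $ i" by auto
  assume "p $ i < q $ i"
  then have "log (K i) (p $ i) < log (K i) (q $ i)" using K pq by simp
  then have "real n + log (K i) (p $ i) \<le> log (K i) (q $ i)" using n by linarith
  then have "K i powr (real n + log (K i) (p $ i)) \<le> K i powr log (K i) (q $ i)"
    using K by (intro powr_mono) auto
  then show "K i ^ n * p $ i \<le> q $ i" using K pq by (simp add: powr_add powr_realpow)
qed

theorem theorem4p15:
  fixes m r :: nat
    and K :: "'d::{finite,linorder} \<Rightarrow> real"
    and P :: "(real ^ 'd::{finite,linorder}) set"
  assumes "m \<ge> 2"
    and "stretching_constants m K"
    and "r \<ge> 1"
    and "P \<subseteq> bounding_box m K"
    and "card P = tverberg_number CARD('d) r"
    and "\<And>p q. p \<in> P \<Longrightarrow> q \<in> P \<Longrightarrow> p \<noteq> q \<Longrightarrow> far_apart K (2 * real CARD('d) + 3) p q"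
  shows "card (tverberg_partitions r P) = fact (r - 1) ^ CARD('d)"
proof -
  define d where "d = CARD('d)"
  have d: "d \<ge> 1" by (simp add: d_def Suc_le_eq)
  obtain e :: "nat \<Rightarrow> 'd" where e: "bij_betw e {1..d} UNIV" "e 1 = Min UNIV"
    "\<And>k. 1 < k \<Longrightarrow> k \<le> d \<Longrightarrow> e k \<noteq> Min UNIV \<and> Max {..<e k} = e (k - 1)"
    using ex_rank_enumeration unfolding d_def by blast
  define w where "w p k = (if k = 0 then 1 else p $ e k)" for p :: "(real, 'd) vec" and k
  define K' where "K' k = K (e k)" for k
  have finP: "finite P" using assms(5) by (intro card_ge_0_finite) (simp add: tverberg_number_def)
  have cardP: "card P = (r - 1) * (d + 1) + 1" using assms(5) by (simp add: tverberg_number_def d_def)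
  have K2: "K' k \<ge> 2" for k using stretching_constants_ge_2[OF assms(2)] by (simp add: K'_def)
  have far: "far_apart K (real (2 * d + 3)) p q" if "p \<in> P" "q \<in> P" "p \<noteq> q" for p q
    using assms(6)[OF that] by (simp add: d_def add.commute)
  have K_Suc: "2 * (real d)^2 * K' k ^ m \<le> K' (Suc k)" if "0 < k" "Suc k \<le> d" for k
    using e(3)[of "Suc k"] that assms(2) unfolding stretching_constants_def
    by (auto simp: K'_def d_def)
  \<comment> \<open>The hypothesis compares only neighbouring constants;
    \<open>K' i \<le> K' k\<close> carries the bound across the directions in between.\<close>
  have K_mono: "2 * (real d)^2 * K' i ^ m \<le> K' k" if "0 < i" "i < k" "k \<le> d" for i k
    using that(2,3)
  proof (induction k)
    case (Suc k)
    show ?case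
    proof (cases "i = k")
      case True
      then show ?thesis using K_Suc that(1) Suc.prems by simp
    next
      case False
      then have IH: "2 * (real d)^2 * K' i ^ m \<le> K' k" using Suc by simp
      have d2: "1 \<le> 2 * (real d)^2" using d one_le_power[of "real d" 2] by linarith
      have "K' i ^ 1 \<le> K' i ^ m" using K2[of i] assms(1) by (intro power_increasing) auto
      also have "\<dots> \<le> 2 * (real d)^2 * K' i ^ m"
        using d2 K2[of i] mult_right_mono[of 1 "2 * (real d)^2" "K' i ^ m"] by simp
      finally have "K' i \<le> K' k" using IH by simp
      have "2 * (real d)^2 * K' i ^ m \<le> 2 * (real d)^2 * K' k ^ m"
        using K2[of i] \<open>K' i \<le> K' k\<close> by (intro mult_left_mono power_mono) auto
      also have "\<dots> \<le> K' (Suc k)" using K_Suc[of k] that(1) Suc.prems False by simp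
      finally show ?thesis .
    qed
  qed simp
  have box: "1 \<le> p $ i" "p $ i \<le> K i ^ (m - 1)" if "p \<in> P" for p i
    using that assms(4) by (auto simp: bounding_box_def mem_box_cart)
  have inj: "p = q" if "p \<in> P" "q \<in> P" "0 < k" "w p k = w q k" for p q k
    using far_apart_gap(2)[OF assms(2) _ _ far, of p q "e k"] that assms(4) by (auto simp: w_def)
  have "inj_on (\<lambda>p. w p k) P" if "0 < k" for k using inj that by (auto simp: inj_on_def)
  then obtain lv piv where gl: "greedy_levels d r P lv piv"
    and above: "\<forall>p\<in>P. \<forall>k. 0 < k \<longrightarrow> k \<le> d \<longrightarrow> lv p = k \<longrightarrow> w (piv k) k < w p k"
    and below: "\<forall>p\<in>P. \<forall>k. 0 < k \<longrightarrow> k \<le> d \<longrightarrow> lv p < k \<longrightarrow> w p k \<le> w (piv k) k"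
    using ex_greedy_levels[OF finP cardP assms(3), of w] by blast
  interpret greedy_levels d r P lv piv by (rule gl)
  interpret stretched_points d r P lv piv m K' w
  proof
    show "1 \<le> d" "1 \<le> m" using d assms(1) by auto
    show "2 \<le> K' k" for k by (rule K2)
    show "2 * (real d)^2 * K' i ^ m \<le> K' k" if "0 < i" "i < k" "k \<le> d" for i k
      using that by (rule K_mono)
    show "w p 0 = 1" for p by (simp add: w_def)
    show "1 \<le> w p k" "w p k \<le> K' k ^ (m - 1)" if "p \<in> P" "0 < k" "k \<le> d" for p k
      using box[OF that(1)] that(2) by (auto simp: w_def K'_def)
    show "p = q" if "p \<in> P" "q \<in> P" "0 < k" "k \<le> d" "w p k = w q k" for p q k
      using inj that by blast
    show "K' k ^ (2 * d + 3) * w p k \<le> w q k"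
      if "p \<in> P" "q \<in> P" "0 < k" "k \<le> d" "w p k < w q k" for p q k
    proof -
      have "p \<noteq> q" using that by auto
      then show ?thesis
        using far_apart_gap(1)[OF assms(2) _ _ far, of p q "e k"] that assms(4)
        by (auto simp: w_def K'_def)
    qed
  qed (use above below in auto)
  have "tverberg_partitions r P \<subseteq> transversal_partitions"
  proof
    fix \<P> assume "\<P> \<in> tverberg_partitions r P"
    then obtain x where part: "partition_on P \<P>" and card: "card \<P> = r"
      and x: "\<And>A. A \<in> \<P> \<Longrightarrow> x \<in> convex hull A"
      by (auto simp: tverberg_partitions_def)
    have "\<exists>u. (\<forall>p\<in>A. 0 \<le> u p) \<and> sum u A = 1 \<and> (\<Sum>p\<in>A. u p *\<^sub>R p) = x" if "A \<in> \<P>" for A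
    proof -
      have "finite A" using that partition_onD1[OF part] finP by (auto intro: finite_subset)
      then show ?thesis using x[OF that] by (auto simp: convex_hull_finite)
    qed
    then obtain u where u: "\<And>A. A \<in> \<P> \<Longrightarrow>
      (\<forall>p\<in>A. 0 \<le> u A p) \<and> sum (u A) A = 1 \<and> (\<Sum>p\<in>A. u A p *\<^sub>R p) = x" by metis
    have wsum: "(\<Sum>p\<in>A. u A p * w p k) = w x k" if "A \<in> \<P>" for A k
    proof (cases "k = 0")
      case False
      have "(\<Sum>p\<in>A. u A p * w p k) = (\<Sum>p\<in>A. u A p *\<^sub>R p) $ e k" using False by (simp add: w_def)
      then show ?thesis using u[OF that] False by (simp add: w_def)
    qed (use u[OF that] in \<open>simp add: w_def\<close>)
    have "\<exists>!p. p \<in> A \<inter> E k" if "A \<in> \<P>" "k \<le> d" for A k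
      by (rule transversal_of_common_point[OF part card, of u "w x"])
        (use u wsum that in \<open>auto simp: w_def\<close>)
    then show "\<P> \<in> transversal_partitions" using part by (simp add: transversal_partitions_def)
  qed
  moreover have "transversal_partitions \<subseteq> tverberg_partitions r P"
  proof
    fix \<P> assume "\<P> \<in> transversal_partitions"
    then have part: "partition_on P \<P>" and tr: "\<And>A k. A \<in> \<P> \<Longrightarrow> k \<le> d \<Longrightarrow> \<exists>!p. p \<in> A \<inter> E k"
      by (auto simp: transversal_partitions_def)
    have card: "card \<P> = r" using part tr by (rule transversal_card)
    have fin\<P>: "finite \<P>" using part finP finite_elements by blast
    have ne\<P>: "\<P> \<noteq> {}" using card assms(3) by auto
    have finA: "finite A" "A \<noteq> {}" if "A \<in> \<P>" for A
      using that partition_onD1[OF part] partition_onD3[OF part] finP by (auto intro: finite_subset)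
    obtain x c where c0: "(\<Sum>A\<in>\<P>. c A) = 0"
      and c: "\<And>A p. A \<in> \<P> \<Longrightarrow> p \<in> A \<Longrightarrow> 0 \<le> c A \<bullet> (p - x)"
      and hull: "\<And>A. A \<in> \<P> \<Longrightarrow> c A = 0 \<Longrightarrow> x \<in> convex hull A"
      using ex_common_point_or_separating[OF fin\<P> ne\<P> finA] by metis
    \<comment> \<open>The affine function \<open>p \<mapsto> c A \<bullet> (p - x)\<close> in
      homogeneous form, with its constant term at index 0.\<close>
    define c' where "c' A k = (if k = 0 then - (c A \<bullet> x) else c A $ e k)" for A k
    have c'_sum: "(\<Sum>i\<le>d. c' A i * w p i) = c A \<bullet> (p - x)" for A p
    proof -
      have "(\<Sum>i\<le>d. c' A i * w p i) = - (c A \<bullet> x) + (\<Sum>i\<in>{1..d}. c A $ e i * p $ e i)"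
        by (simp add: sum.atMost_shift sum.atLeast1_atMost_eq c'_def w_def lessThan_atLeast0)
      also have "(\<Sum>i\<in>{1..d}. c A $ e i * p $ e i) = (\<Sum>j\<in>UNIV. c A $ j * p $ j)"
        using e(1) by (rule sum.reindex_bij_betw)
      also have "\<dots> = c A \<bullet> p" by (simp add: inner_vec_def)
      finally show ?thesis by (simp add: inner_diff_right)
    qed
    have c'0: "(\<Sum>A\<in>\<P>. c' A k) = 0" for k
    proof (cases "k = 0")
      case True
      have "(\<Sum>A\<in>\<P>. c' A k) = - ((\<Sum>A\<in>\<P>. c A) \<bullet> x)"
        using True by (simp add: c'_def sum_negf inner_sum_left)
      then show ?thesis using c0 by simp
    next
      case False
      have "(\<Sum>A\<in>\<P>. c' A k) = (\<Sum>A\<in>\<P>. c A) $ e k" using False by (simp add: c'_def)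
      then show ?thesis using c0 by simp
    qed
    have "c A = 0" if A: "A \<in> \<P>" for A
    proof -
      have "c A $ j = 0" for j
      proof -
        obtain k where k: "k \<in> {1..d}" "e k = j" using e(1) by (metis UNIV_I bij_betw_def imageE)
        have "c' A k = 0"
          by (rule separating_family_zero[OF part tr]) (use c'0 c'_sum c A k in auto)
        then show ?thesis using k by (simp add: c'_def)
      qed
      then show ?thesis by (simp add: vec_eq_iff)
    qed
    then have "(\<Inter>A\<in>\<P>. convex hull A) \<noteq> {}" using hull by blast
    then show "\<P> \<in> tverberg_partitions r P" using part card by (simp add: tverberg_partitions_def)
  qed
  ultimately have "tverberg_partitions r P = transversal_partitions" by blast
  then show ?thesis using card_transversal_partitions by (simp add: d_def)
qed

end
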